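(* Let $(\theta,\varphi)$ be a Markov random dynamical system (RDS) over a probability space $(\Omega,\mathcal F,\mathbb P)$ on a countable state space $\mathbb X$, representing an irreducible and positive recurrent Markov chain with stationary distribution $\pi$, and let $A$ be its random attractor (as defined in the context). For $x\in\mathbb X$ let $$T_A(\omega,x):=\min\{n\in\mathbb N\mid \varphi^n_\omega(x)\in A(\theta_n\omega)\}$$ be the hitting time of the attractor. Assume that the associated Markov chain is ergodic of degree 2. Then the expected hitting time of the attractor $\mathbb E[T_A(\omega,x)]$ is finite for all $x\in\mathbb X$, and $$\sum_{x\in\mathbb X}\pi(x)\,\mathbb E[T_A(\omega,x)]<\infty.$$
   Context: $\mathbb N$ includes $0$. $\mathbb X$ is countable with the discrete topology and the power set $\sigma$-algebra $\mathcal P(\mathbb X)$; compact means finite. Expectations $\mathbb E$ are with respect to $\mathbb P$ over $\omega$. RDS: An RDS $(\theta,\varphi)$ on $\mathbb X$ consists of a probability space $(\Omega,\mathcal F,\mathbb P)$; a group $(\theta_n)_{n\in\mathbb Z}$ of bimeasurable measure-preserving maps $\theta_n:\Omega\to\Omega$ with $\theta_0=\mathrm{id}$, $\theta_{n+m}=\theta_n\circ\theta_m$, where $\theta:=\theta_1$ is assumed ergodic with respect to $\mathbb P$; and an $(\mathcal F\otimes\mathcal P(\mathbb N)\otimes\mathcal P(\mathbb X))$-measurable map $\varphi:\Omega\times\mathbb N\times\mathbb X\to\mathbb X$, $(\omega,n,x)\mapsto\varphi^n_\omega(x)$, with $\varphi^0_\omega(x)=x$ and $\varphi^{n+m}_\omega(x)=\varphi^n_{\theta_m\omega}(\varphi^m_\omega(x))$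 for all $\omega\in\Omega$, $m,n\in\mathbb N$, $x\in\mathbb X$. Write $\varphi_\omega:=\varphi^1_\omega$; for $K\subset\mathbb X$, $\varphi^n_\omega(K)=\{\varphi^n_\omega(x):x\in K\}$. Markov RDS: for $s<t$ in $\mathbb Z$, $\mathcal F_s^t\subset\mathcal F$ is the $\sigma$-algebra generated by the $\mathbb P$-null sets of $\mathcal F$ and the random variables $\omega\mapsto\varphi^n_{\theta_m\omega}(x)$ for $x\in\mathbb X$ and integers $m,n$ with $s\le m\le m+n\le t$. $\mathcal F_{-\infty}^t:=\sigma(\mathcal F_s^t: s<t)$, $\mathcal F_s^\infty:=\sigma(\mathcal F_s^t: t>s)$. The RDS is Markov if $\mathcal F_{-\infty}^0$ and $\mathcal F_0^\infty$ are independent. Then $X_n(\omega)=\varphi^n_\omega(x)$ is a time-homogeneous Markov chain with transition probabilities $P(x,y)=\mathbb P(\varphi_\omega(x)=y)$; the RDS is said to represent this (associated) Markov chain. Compact random set: a map $B:\Omega\to\mathcal P(\mathbb X)$ such that $\omega\mapsto\mathbf 1_{B(\omega)}(x)$ is measurable for each $x$ and $B(\omega)$ is finite for $\mathbb P$-a.e. $\omega$. It is invariant if also $\varphi_\omega(B(\omega))=B(\theta\omega)$ $\mathbb P$-a.s. Random attractor: for an RDS as in the claim there exists an invariant compact random set $A$, unique up to $\mathbb P$-null sets, with $\omega\mapsto \mathbf 1_{A(\omega)}(x)$ being $\mathcal F_{-\infty}^0$-measurable for each $x$, which is a forward attractor for compact random sets, i.e. for each compact random set $B$, $\mathbb P(\exists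 N\ \forall n\ge N:\varphi^n_\omega(B(\omega))\subset A(\theta_n\omega))=1$, and a pullback attractor for finite deterministic sets, i.e. for each finite $B\subset\mathbb X$, $\mathbb P(\exists N\ \forall n\ge N:\varphi^n_{\theta_{-n}\omega}(B)\subset A(\omega))=1$. This $A$ is called the random attractor. There is a constant $\kappa\in\mathbb N_{>0}$ with $|A(\omega)|=\kappa$ for $\mathbb P$-a.e. $\omega$, and $\mathbb P(x\in A(\omega))=\kappa\pi(x)$ for all $x\in\mathbb X$. Ergodic of degree 2: the Markov chain $(X_n)$ is ergodic of degree 2 if $\mathbb E_x[\tau_x^2]<\infty$ for some $x\in\mathbb X$, where $\tau_x:=\min\{n\ge1\mid X_n=x\}$ and $\mathbb E_x$ is expectation conditioned on $X_0=x$. *)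

theory Defs
  imports "HOL-Probability.Probability"
begin

text \<open>
  The state space is the whole type \<open>'x\<close>, with the power set \<sigma>-algebra. Maps on \<open>\<Omega>\<close> are
  only constrained on \<open>space M\<close>. Bimeasurability of \<open>\<theta> n\<close> is covered by the measurability
  of its inverse \<open>\<theta> (- n)\<close>.
\<close>

locale rds = prob_space M
  for M :: "'w measure" +
  fixes \<theta> :: "int \<Rightarrow> 'w \<Rightarrow> 'w"
    and \<phi> :: "'w \<Rightarrow> nat \<Rightarrow> 'x::countable \<Rightarrow> 'x"
  assumes theta_measurable: "\<And>n. \<theta> n \<in> M \<rightarrow>\<^sub>M M"
    and theta_preserving: "\<And>n. distr M M (\<theta> n) = M"
    and theta_0: "\<And>\<omega>. \<omega> \<in> space M \<Longrightarrow> \<theta> 0 \<omega> = \<omega>"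
    and theta_add: "\<And>n m \<omega>. \<omega> \<in> space M \<Longrightarrow> \<theta> (n + m) \<omega> = \<theta> n (\<theta> m \<omega>)"
    and theta_ergodic:
      "\<And>E. E \<in> sets M \<Longrightarrow> \<theta> 1 -` E \<inter> space M = E \<Longrightarrow> prob E = 0 \<or> prob E = 1"
    and phi_measurable:
      "(\<lambda>(\<omega>, n, x). \<phi> \<omega> n x)
         \<in> M \<Otimes>\<^sub>M (count_space UNIV \<Otimes>\<^sub>M count_space UNIV) \<rightarrow>\<^sub>M count_space UNIV"
    and phi_0: "\<And>\<omega> x. \<omega> \<in> space M \<Longrightarrow> \<phi> \<omega> 0 x = x"
    and phi_cocycle:
      "\<And>\<omega> m n x. \<omega> \<in> space M \<Longrightarrow> \<phi> \<omega> (n + m) x = \<phi> (\<theta> (int m) \<omega>) n (\<phi> \<omega> m x)"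

definition F_between ::
    "'w measure \<Rightarrow> (int \<Rightarrow> 'w \<Rightarrow> 'w) \<Rightarrow> ('w \<Rightarrow> nat \<Rightarrow> 'x \<Rightarrow> 'x) \<Rightarrow> int \<Rightarrow> int \<Rightarrow> 'w measure"
  where "F_between M \<theta> \<phi> s t = sigma (space M)
    (null_sets M \<union>
     {(\<lambda>\<omega>. \<phi> (\<theta> m \<omega>) n x) -` S \<inter> space M | m n x S. s \<le> m \<and> m + int n \<le> t})"

definition F_past ::
    "'w measure \<Rightarrow> (int \<Rightarrow> 'w \<Rightarrow> 'w) \<Rightarrow> ('w \<Rightarrow> nat \<Rightarrow> 'x \<Rightarrow> 'x) \<Rightarrow> int \<Rightarrow> 'w measure"
  where "F_past M \<theta> \<phi> t = sigma (space M) (\<Union>s\<in>{..<t}. sets (F_between M \<theta> \<phi> s t))"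

definition F_future ::
    "'w measure \<Rightarrow> (int \<Rightarrow> 'w \<Rightarrow> 'w) \<Rightarrow> ('w \<Rightarrow> nat \<Rightarrow> 'x \<Rightarrow> 'x) \<Rightarrow> int \<Rightarrow> 'w measure"
  where "F_future M \<theta> \<phi> s = sigma (space M) (\<Union>t\<in>{s<..}. sets (F_between M \<theta> \<phi> s t))"

locale markov_rds = rds M \<theta> \<phi>
  for M :: "'w measure"
    and \<theta> :: "int \<Rightarrow> 'w \<Rightarrow> 'w"
    and \<phi> :: "'w \<Rightarrow> nat \<Rightarrow> 'x::countable \<Rightarrow> 'x" +
  assumes past_future_indep: "indep_set (sets (F_past M \<theta> \<phi> 0)) (sets (F_future M \<theta> \<phi> 0))"

text \<open>
  The chain started at \<open>x\<close> is the process \<open>X\<^sub>n(\<omega>) = \<phi> \<omega> n x\<close> under \<open>M\<close>, so that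
  \<open>\<bbbP>\<^sub>x\<close> and \<open>\<bbbE>\<^sub>x\<close> are probability and expectation over \<open>M\<close> for this process.
\<close>

definition trans_prob :: "'w measure \<Rightarrow> ('w \<Rightarrow> nat \<Rightarrow> 'x \<Rightarrow> 'x) \<Rightarrow> nat \<Rightarrow> 'x \<Rightarrow> 'x \<Rightarrow> real"
  where "trans_prob M \<phi> n x y = \<P>(\<omega> in M. \<phi> \<omega> n x = y)"

definition irreducible_chain :: "'w measure \<Rightarrow> ('w \<Rightarrow> nat \<Rightarrow> 'x \<Rightarrow> 'x) \<Rightarrow> bool"
  where "irreducible_chain M \<phi> \<longleftrightarrow> (\<forall>x y. \<exists>n. trans_prob M \<phi> n x y > 0)"

definition stationary_distribution ::
    "'w measure \<Rightarrow> ('w \<Rightarrow> nat \<Rightarrow> 'x \<Rightarrow> 'x) \<Rightarrow> 'x pmf \<Rightarrow> bool"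
  where "stationary_distribution M \<phi> \<pi> \<longleftrightarrow>
    (\<forall>y. ((\<lambda>x. pmf \<pi> x * trans_prob M \<phi> 1 x y) has_sum pmf \<pi> y) UNIV)"

text \<open>The minimum of the empty set is \<open>\<infinity>\<close>, both here and in \<open>hitting_time\<close>.\<close>

definition return_time :: "('w \<Rightarrow> nat \<Rightarrow> 'x \<Rightarrow> 'x) \<Rightarrow> 'w \<Rightarrow> 'x \<Rightarrow> enat"
  where "return_time \<phi> \<omega> x = (INF n\<in>{n. 1 \<le> n \<and> \<phi> \<omega> n x = x}. enat n)"

definition positive_recurrent_chain :: "'w measure \<Rightarrow> ('w \<Rightarrow> nat \<Rightarrow> 'x \<Rightarrow> 'x) \<Rightarrow> bool"
  where "positive_recurrent_chain M \<phi> \<longleftrightarrow>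
    (\<forall>x. (\<integral>\<^sup>+ \<omega>. ennreal_of_enat (return_time \<phi> \<omega> x) \<partial>M) < \<infinity>)"

definition ergodic_of_degree_2 :: "'w measure \<Rightarrow> ('w \<Rightarrow> nat \<Rightarrow> 'x \<Rightarrow> 'x) \<Rightarrow> bool"
  where "ergodic_of_degree_2 M \<phi> \<longleftrightarrow>
    (\<exists>x. (\<integral>\<^sup>+ \<omega>. (ennreal_of_enat (return_time \<phi> \<omega> x))\<^sup>2 \<partial>M) < \<infinity>)"

definition compact_random_set :: "'w measure \<Rightarrow> ('w \<Rightarrow> 'x set) \<Rightarrow> bool"
  where "compact_random_set M B \<longleftrightarrow>
    (\<forall>x. (\<lambda>\<omega>. indicat_real (B \<omega>) x) \<in> borel_measurable M) \<and> (AE \<omega> in M. finite (B \<omega>))"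

definition invariant_compact_random_set ::
    "'w measure \<Rightarrow> (int \<Rightarrow> 'w \<Rightarrow> 'w) \<Rightarrow> ('w \<Rightarrow> nat \<Rightarrow> 'x \<Rightarrow> 'x) \<Rightarrow> ('w \<Rightarrow> 'x set) \<Rightarrow> bool"
  where "invariant_compact_random_set M \<theta> \<phi> B \<longleftrightarrow>
    compact_random_set M B \<and> (AE \<omega> in M. \<phi> \<omega> 1 ` B \<omega> = B (\<theta> 1 \<omega>))"

definition random_attractor ::
    "'w measure \<Rightarrow> (int \<Rightarrow> 'w \<Rightarrow> 'w) \<Rightarrow> ('w \<Rightarrow> nat \<Rightarrow> 'x \<Rightarrow> 'x) \<Rightarrow> ('w \<Rightarrow> 'x set) \<Rightarrow> bool"
  where "random_attractor M \<theta> \<phi> A \<longleftrightarrow>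
    invariant_compact_random_set M \<theta> \<phi> A \<and>
    (\<forall>x. (\<lambda>\<omega>. indicat_real (A \<omega>) x) \<in> borel_measurable (F_past M \<theta> \<phi> 0)) \<and>
    (\<forall>B. compact_random_set M B \<longrightarrow>
       \<P>(\<omega> in M. \<exists>N. \<forall>n\<ge>N. \<phi> \<omega> n ` B \<omega> \<subseteq> A (\<theta> (int n) \<omega>)) = 1) \<and>
    (\<forall>B. finite B \<longrightarrow>
       \<P>(\<omega> in M. \<exists>N. \<forall>n\<ge>N. \<phi> (\<theta> (- int n) \<omega>) n ` B \<subseteq> A \<omega>) = 1)"

definition hitting_time ::
    "(int \<Rightarrow> 'w \<Rightarrow> 'w) \<Rightarrow> ('w \<Rightarrow> nat \<Rightarrow> 'x \<Rightarrow> 'x) \<Rightarrow> ('w \<Rightarrow> 'x set) \<Rightarrow> 'w \<Rightarrow> 'x \<Rightarrow> enat"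
  where "hitting_time \<theta> \<phi> A \<omega> x = (INF n\<in>{n. \<phi> \<omega> n x \<in> A (\<theta> (int n) \<omega>)}. enat n)"

end

theory Submission
  imports Defs
begin

text \<open>
  Follow the tuple consisting of \<open>\<phi>\<^sup>k(x)\<close> and the points of \<open>A\<close>. Fix a state \<open>a\<close> with
  \<open>E\<^sub>a[\<tau>\<^sub>a\<^sup>2] < \<infinity>\<close> and let \<open>V(y)\<close> be the expected time spent outside a finite set \<open>C \<ni> a\<close>
  before hitting \<open>a\<close>. Then \<open>V\<close> decreases in mean by 1 off \<open>C\<close> and does not increase on \<open>C - {a}\<close>;
  at \<open>a\<close> it increases by at most 1/2 if \<open>C\<close> is large. Before merging the points of the tuple are
  distinct, so at most one of them is at \<open>a\<close>, and the sum of \<open>V\<close> over the tuple decreases in mean by 1/2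
  unless the whole tuple lies in \<open>C\<close>. From each of the finitely many tuples in \<open>C\<close> merging happens
  within a common time \<open>N\<close> with probability at least 1/2, so the expected number of unmerged visits
  to \<open>C\<close> is at most \<open>2N\<close>. Hence \<open>E[T\<^sub>A(x)] \<le> 2 (V(x) + E[\<Sum>y\<in>A. V(y)] + 2N)\<close>, and degree 2
  makes \<open>V\<close> integrable with respect to every finite invariant measure.
\<close>

section \<open>The Markov property\<close>

lemma (in rds) theta_space: "\<omega> \<in> space M \<Longrightarrow> \<theta> n \<omega> \<in> space M"
  using theta_measurable[of n] by (auto dest: measurable_space)

lemma (in rds) theta_cancel: "\<omega> \<in> space M \<Longrightarrow> \<theta> n (\<theta> (- n) \<omega>) = \<omega>"
  using theta_add[of \<omega> n "- n"] theta_0 by simp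

lemma (in rds) phi_measurable_at [measurable]: "(\<lambda>\<omega>. \<phi> \<omega> n x) \<in> M \<rightarrow>\<^sub>M count_space UNIV"
proof -
  have "(\<lambda>\<omega>. (\<omega>, n, x)) \<in> M \<rightarrow>\<^sub>M M \<Otimes>\<^sub>M (count_space UNIV \<Otimes>\<^sub>M count_space UNIV)"
    by measurable
  from measurable_compose[OF this phi_measurable] show ?thesis by simp
qed

lemma (in rds) phi_theta_measurable [measurable]:
  "(\<lambda>\<omega>. \<phi> (\<theta> m \<omega>) n x) \<in> M \<rightarrow>\<^sub>M count_space UNIV"
  using measurable_compose[OF theta_measurable phi_measurable_at] .

lemma (in rds) nn_integral_theta:
  assumes "f \<in> borel_measurable M"
  shows "(\<integral>\<^sup>+ \<omega>. f (\<theta> n \<omega>) \<partial>M) = (\<integral>\<^sup>+ \<omega>. f \<omega> \<partial>M)"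
proof -
  have "(\<integral>\<^sup>+ \<omega>. f \<omega> \<partial>M) = (\<integral>\<^sup>+ \<omega>. f \<omega> \<partial>distr M M (\<theta> n))"
    by (simp add: theta_preserving)
  also have "\<dots> = (\<integral>\<^sup>+ \<omega>. f (\<theta> n \<omega>) \<partial>M)"
    using assms by (intro nn_integral_distr theta_measurable) auto
  finally show ?thesis ..
qed

lemma (in rds) emeasure_theta:
  assumes "{\<omega> \<in> space M. P \<omega>} \<in> sets M"
  shows "emeasure M {\<omega> \<in> space M. P (\<theta> n \<omega>)} = emeasure M {\<omega> \<in> space M. P \<omega>}"
proof -
  have "emeasure M {\<omega> \<in> space M. P \<omega>} = emeasure (distr M M (\<theta> n)) {\<omega> \<in> space M. P \<omega>}"
    by (simp add: theta_preserving)
  also have "\<dots> = emeasure M (\<theta> n -` {\<omega> \<in> space M. P \<omega>} \<inter> space M)"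
    by (rule emeasure_distr) (use assms theta_measurable in auto)
  also have "\<theta> n -` {\<omega> \<in> space M. P \<omega>} \<inter> space M = {\<omega> \<in> space M. P (\<theta> n \<omega>)}"
    using theta_space by auto
  finally show ?thesis ..
qed

lemma (in rds) AE_theta:
  assumes "AE \<omega> in M. P \<omega>"
  shows "AE \<omega> in M. P (\<theta> n \<omega>)"
proof -
  have "AE \<omega> in distr M M (\<theta> n). P \<omega>"
    by (subst theta_preserving) (rule assms)
  thus ?thesis
    by (rule AE_distrD[OF theta_measurable])
qed

section \<open>The sigma-algebras of the past and of the future\<close>

context rds
begin

lemma sets_F_between:
  "sets (F_between M \<theta> \<phi> s t) = sigma_sets (space M) (null_sets M \<union>
     {(\<lambda>\<omega>. \<phi> (\<theta> m \<omega>) n x) -` S \<inter> space M | m n x S. s \<le> m \<and> m + int n \<le> t})"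
  unfolding F_between_def
  by (rule sets_measure_of) (auto dest: null_setsD2 sets.sets_into_space)

lemma sets_F_between_subset: "sets (F_between M \<theta> \<phi> s t) \<subseteq> sets M"
  unfolding sets_F_between
  by (rule sets.sigma_sets_subset) (auto intro!: measurable_sets[OF phi_theta_measurable])

lemma sets_F_past:
  "sets (F_past M \<theta> \<phi> t) = sigma_sets (space M) (\<Union>s\<in>{..<t}. sets (F_between M \<theta> \<phi> s t))"
  unfolding F_past_def
  by (rule sets_measure_of) (use sets_F_between_subset sets.sets_into_space in blast)

lemma sets_F_future:
  "sets (F_future M \<theta> \<phi> s) = sigma_sets (space M) (\<Union>t\<in>{s<..}. sets (F_between M \<theta> \<phi> s t))"
  unfolding F_future_def
  by (rule sets_measure_of) (use sets_F_between_subset sets.sets_into_space in blast)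

lemma space_F_past [simp]: "space (F_past M \<theta> \<phi> t) = space M"
  unfolding F_past_def
  by (rule space_measure_of) (use sets_F_between_subset sets.sets_into_space in blast)

lemma space_F_future [simp]: "space (F_future M \<theta> \<phi> t) = space M"
  unfolding F_future_def
  by (rule space_measure_of) (use sets_F_between_subset sets.sets_into_space in blast)

lemma sets_F_past_subset: "sets (F_past M \<theta> \<phi> t) \<subseteq> sets M"
  unfolding sets_F_past
  by (rule sets.sigma_sets_subset) (use sets_F_between_subset in blast)

lemma sets_F_future_subset: "sets (F_future M \<theta> \<phi> t) \<subseteq> sets M"
  unfolding sets_F_future
  by (rule sets.sigma_sets_subset) (use sets_F_between_subset in blast)

lemma phi_past_measurable:
  "(\<lambda>\<omega>. \<phi> (\<theta> (- int k) \<omega>) k x) \<in> F_past M \<theta> \<phi> 0 \<rightarrow>\<^sub>M count_space UNIV"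
proof (rule measurableI)
  fix S :: "'x set"
  let ?E = "(\<lambda>\<omega>. \<phi> (\<theta> (- int k) \<omega>) k x) -` S \<inter> space M"
  \<comment> \<open>\<open>F_past\<close> collects only starting times strictly below 0; the extra
    \<open>- 1\<close> covers the case \<open>k = 0\<close>.\<close>
  have "?E \<in> sets (F_between M \<theta> \<phi> (- int k - 1) 0)"
    unfolding sets_F_between
    by (intro sigma_sets.Basic UnI2 CollectI exI[of _ "- int k"] exI[of _ k] exI[of _ x] exI[of _ S]) auto
  thus "(\<lambda>\<omega>. \<phi> (\<theta> (- int k) \<omega>) k x) -` S \<inter> space (F_past M \<theta> \<phi> 0) \<in> sets (F_past M \<theta> \<phi> 0)"
    unfolding sets_F_past space_F_past
    by (intro sigma_sets.Basic UN_I[of "- int k - 1"]) auto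
qed simp

lemma phi_future_measurable [measurable]:
  "(\<lambda>\<omega>. \<phi> \<omega> n x) \<in> F_future M \<theta> \<phi> 0 \<rightarrow>\<^sub>M count_space UNIV"
proof (rule measurableI)
  fix S :: "'x set"
  \<comment> \<open>The identity map \<open>\<theta> 0\<close> is inserted to match the form of the
    generators of \<open>F_between\<close>; the upper end \<open>int n + 1\<close> stays strictly
    positive when \<open>n = 0\<close>.\<close>
  let ?E = "(\<lambda>\<omega>. \<phi> (\<theta> 0 \<omega>) n x) -` S \<inter> space M"
  have "?E \<in> sets (F_between M \<theta> \<phi> 0 (int n + 1))"
    unfolding sets_F_between by (rule sigma_sets.Basic) fastforce
  hence "?E \<in> sets (F_future M \<theta> \<phi> 0)"
    unfolding sets_F_future by (intro sigma_sets.Basic UN_I[of "int n + 1"]) auto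
  also have "?E = (\<lambda>\<omega>. \<phi> \<omega> n x) -` S \<inter> space (F_future M \<theta> \<phi> 0)"
    using theta_0 by auto
  finally show "(\<lambda>\<omega>. \<phi> \<omega> n x) -` S \<inter> space (F_future M \<theta> \<phi> 0) \<in> sets (F_future M \<theta> \<phi> 0)" .
qed simp

lemma borel_measurable_future:
  "f \<in> borel_measurable (F_future M \<theta> \<phi> 0) \<Longrightarrow> f \<in> borel_measurable M"
  using sets_F_future_subset[of 0] by (auto simp: measurable_def)

end

section \<open>Independence of past and future as a Markov property\<close>

context markov_rds
begin

text \<open>The Markov assumption speaks of events. Induction over nonnegative measurable functions
  lifts it from indicators of future events to all future-measurable \<open>f\<close>.\<close>

lemma nn_integral_past_future:
  fixes f :: "'w \<Rightarrow> ennreal"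
  assumes E: "E \<in> sets (F_past M \<theta> \<phi> 0)" and f: "f \<in> borel_measurable (F_future M \<theta> \<phi> 0)"
  shows "(\<integral>\<^sup>+ \<omega>. indicator E \<omega> * f \<omega> \<partial>M) = emeasure M E * (\<integral>\<^sup>+ \<omega>. f \<omega> \<partial>M)"
proof -
  have EM [measurable]: "E \<in> sets M"
    using E sets_F_past_subset by blast
  show ?thesis
    using f
  proof (induction rule: borel_measurable_induct)
    case (cong f g)
    have "(\<integral>\<^sup>+ \<omega>. indicator E \<omega> * f \<omega> \<partial>M) = (\<integral>\<^sup>+ \<omega>. indicator E \<omega> * g \<omega> \<partial>M)"
      "(\<integral>\<^sup>+ \<omega>. f \<omega> \<partial>M) = (\<integral>\<^sup>+ \<omega>. g \<omega> \<partial>M)"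
      using cong(3) by (auto intro!: nn_integral_cong)
    thus ?case using cong(4) by metis
  next
    case (set B)
    hence [measurable]: "B \<in> sets M"
      using sets_F_future_subset by blast
    have "measure M (E \<inter> B) = measure M E * measure M B"
      by (rule indep_setD[OF past_future_indep E set])
    thus ?case
      by (simp add: nn_integral_cmult[symmetric] indicator_inter_arith[symmetric] emeasure_eq_measure
          ennreal_mult)
  next
    case (mult u c)
    note [measurable] = borel_measurable_future[OF mult(2)]
    show ?case
      using mult by (simp add: nn_integral_cmult mult.left_commute)
  next
    case (add u v)
    note [measurable] = borel_measurable_future[OF add(1)] borel_measurable_future[OF add(3)]
    show ?case
      using add by (simp add: nn_integral_add distrib_left)
  next
    case (seq U)
    note [measurable] = borel_measurable_future[OF seq(1)]
    have "(\<integral>\<^sup>+ \<omega>. indicator E \<omega> * (SUP i. U i) \<omega> \<partial>M) = (\<integral>\<^sup>+ \<omega>. (SUP i. indicator E \<omega> * U i \<omega>) \<partial>M)"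
      by (simp add: SUP_mult_left_ennreal image_comp)
    also have "\<dots> = (SUP i. \<integral>\<^sup>+ \<omega>. indicator E \<omega> * U i \<omega> \<partial>M)"
      using seq(3) by (intro nn_integral_monotone_convergence_SUP)
        (auto simp: incseq_def le_fun_def intro!: mult_left_mono)
    also have "\<dots> = emeasure M E * (SUP i. \<integral>\<^sup>+ \<omega>. U i \<omega> \<partial>M)"
      by (simp add: seq.IH SUP_mult_left_ennreal)
    also have "(SUP i. \<integral>\<^sup>+ \<omega>. U i \<omega> \<partial>M) = (\<integral>\<^sup>+ \<omega>. (SUP i. U i \<omega>) \<partial>M)"
      using seq(3) by (intro nn_integral_monotone_convergence_SUP[symmetric]) auto
    finally show ?case by (simp add: image_comp)
  qed
qed

text \<open>Freezing lemma: a past-measurable \<open>Z\<close> may be held fixed while the future is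
  resampled. As \<open>Z\<close> takes countably many values, it suffices to use independence on
  each event \<open>Z \<omega> = z\<close> and to sum, without conditional expectations.\<close>

lemma markov_property:
  fixes f :: "'z \<Rightarrow> 'w \<Rightarrow> ennreal"
  assumes D: "countable D" "AE \<omega> in M. Z \<omega> \<in> D"
    and Z: "\<And>z. z \<in> D \<Longrightarrow> {\<omega> \<in> space M. Z \<omega> = z} \<in> sets (F_past M \<theta> \<phi> 0)"
    and f: "\<And>z. z \<in> D \<Longrightarrow> f z \<in> borel_measurable (F_future M \<theta> \<phi> 0)"
  shows "(\<integral>\<^sup>+ \<omega>. f (Z \<omega>) \<omega> \<partial>M) = (\<integral>\<^sup>+ \<omega>. (\<integral>\<^sup>+ \<omega>'. f (Z \<omega>) \<omega>' \<partial>M) \<partial>M)"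
proof -
  define E where "E z = {\<omega> \<in> space M. Z \<omega> = z}" for z
  have E: "E z \<in> sets (F_past M \<theta> \<phi> 0)" "E z \<in> sets M" if "z \<in> D" for z
    using Z[OF that] sets_F_past_subset unfolding E_def by auto
  \<comment> \<open>Stated for general \<open>g\<close> because it is used twice: with
    \<open>f\<close> itself, and with the functions constant in \<omega> that arise once the future
    is integrated out.\<close>
  have decomp: "(\<integral>\<^sup>+ \<omega>. g (Z \<omega>) \<omega> \<partial>M) = (\<integral>\<^sup>+ z. (\<integral>\<^sup>+ \<omega>. indicator (E z) \<omega> * g z \<omega> \<partial>M) \<partial>count_space D)"
    if g: "\<And>z. z \<in> D \<Longrightarrow> g z \<in> borel_measurable M" for g :: "'z \<Rightarrow> 'w \<Rightarrow> ennreal"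
  proof -
    have "(\<integral>\<^sup>+ \<omega>. g (Z \<omega>) \<omega> \<partial>M) = (\<integral>\<^sup>+ \<omega>. (\<integral>\<^sup>+ z. indicator (E z) \<omega> * g z \<omega> \<partial>count_space D) \<partial>M)"
    proof (rule nn_integral_cong_AE)
      show "AE \<omega> in M. g (Z \<omega>) \<omega> = (\<integral>\<^sup>+ z. indicator (E z) \<omega> * g z \<omega> \<partial>count_space D)"
        using D(2) AE_space
      proof eventually_elim
        case (elim \<omega>)
        have "(\<integral>\<^sup>+ z. indicator (E z) \<omega> * g z \<omega> \<partial>count_space D)
            = (\<integral>\<^sup>+ z. g (Z \<omega>) \<omega> * indicator {Z \<omega>} z \<partial>count_space D)"
          using elim by (intro nn_integral_cong) (auto simp: E_def indicator_def)
        also have "\<dots> = g (Z \<omega>) \<omega>"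
          using elim by (subst nn_integral_cmult_indicator) auto
        finally show ?case ..
      qed
    qed
    also have "\<dots> = (\<integral>\<^sup>+ z. (\<integral>\<^sup>+ \<omega>. indicator (E z) \<omega> * g z \<omega> \<partial>M) \<partial>count_space D)"
      by (rule nn_integral_count_space_nn_integral[OF D(1)])
         (use E g in \<open>auto intro!: borel_measurable_times\<close>)
    finally show ?thesis .
  qed
  have "(\<integral>\<^sup>+ \<omega>. f (Z \<omega>) \<omega> \<partial>M) = (\<integral>\<^sup>+ z. emeasure M (E z) * (\<integral>\<^sup>+ \<omega>'. f z \<omega>' \<partial>M) \<partial>count_space D)"
    using f by (subst decomp) (auto intro!: nn_integral_cong borel_measurable_future
      nn_integral_past_future E)
  also have "\<dots> = (\<integral>\<^sup>+ \<omega>. (\<integral>\<^sup>+ \<omega>'. f (Z \<omega>) \<omega>' \<partial>M) \<partial>M)"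
    by (subst decomp[of "\<lambda>z _. \<integral>\<^sup>+ \<omega>'. f z \<omega>' \<partial>M"])
       (auto intro!: nn_integral_cong simp: nn_integral_multc E borel_measurable_indicator)
  finally show ?thesis .
qed

lemma markov_property_step:
  assumes f: "\<And>y. f y \<in> borel_measurable (F_future M \<theta> \<phi> 0)"
  shows "(\<integral>\<^sup>+ \<omega>. f (\<phi> \<omega> 1 x) (\<theta> 1 \<omega>) \<partial>M) = (\<integral>\<^sup>+ \<omega>. (\<integral>\<^sup>+ \<omega>'. f (\<phi> \<omega> 1 x) \<omega>' \<partial>M) \<partial>M)"
proof -
  \<comment> \<open>Past and future are separated at time 0, whereas the first step ends at time 1.
    \<open>Z\<close> is that step moved back by one time unit, so it belongs to the past, and
    \<open>Z (\<theta> 1 \<omega>) = \<phi> \<omega> 1 x\<close>.\<close>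
  define Z where "Z \<omega> = \<phi> (\<theta> (- 1) \<omega>) 1 x" for \<omega>
  have [measurable]: "f y \<in> borel_measurable M" for y
    by (rule borel_measurable_future[OF f])
  have Z [measurable]: "Z \<in> M \<rightarrow>\<^sub>M count_space UNIV"
    unfolding Z_def by measurable
  have "(\<integral>\<^sup>+ \<omega>. f (\<phi> \<omega> 1 x) (\<theta> 1 \<omega>) \<partial>M) = (\<integral>\<^sup>+ \<omega>. f (Z (\<theta> 1 \<omega>)) (\<theta> 1 \<omega>) \<partial>M)"
    using theta_cancel[of _ "-1"] by (intro nn_integral_cong) (simp add: Z_def)
  also have "\<dots> = (\<integral>\<^sup>+ \<omega>. f (Z \<omega>) \<omega> \<partial>M)"
    by (rule nn_integral_theta) (rule measurable_compose_countable[OF _ Z], simp)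
  also have "\<dots> = (\<integral>\<^sup>+ \<omega>. (\<integral>\<^sup>+ \<omega>'. f (Z \<omega>) \<omega>' \<partial>M) \<partial>M)"
  proof (rule markov_property[where D = UNIV])
    show "{\<omega> \<in> space M. Z \<omega> = z} \<in> sets (F_past M \<theta> \<phi> 0)" for z
      using measurable_sets[OF phi_past_measurable[of 1 x], of "{z}"]
      by (simp add: Z_def vimage_def Int_def conj_commute)
  qed (auto simp: f)
  also have "\<dots> = (\<integral>\<^sup>+ \<omega>. (\<integral>\<^sup>+ \<omega>'. f (Z (\<theta> 1 \<omega>)) \<omega>' \<partial>M) \<partial>M)"
    by (rule nn_integral_theta[symmetric]) (rule measurable_compose[OF Z], simp)
  also have "\<dots> = (\<integral>\<^sup>+ \<omega>. (\<integral>\<^sup>+ \<omega>'. f (\<phi> \<omega> 1 x) \<omega>' \<partial>M) \<partial>M)"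
    using theta_cancel[of _ "-1"] by (intro nn_integral_cong) (simp add: Z_def)
  finally show ?thesis .
qed

end

section \<open>Taboo Green functions\<close>

lemma ennreal_terms_tendsto_0:
  fixes f :: "nat \<Rightarrow> ennreal"
  assumes "(\<Sum>n. f n) < \<infinity>"
  shows "f \<longlonglongrightarrow> 0"
proof -
  have fin: "f n < top" for n
    using assms ennreal_suminf_lessD[of f top n] by simp
  define r where "r n = enn2real (f n)" for n
  have fr: "f n = ennreal (r n)" for n
    using fin[of n] by (simp add: r_def)
  have "summable r"
  proof (rule summable_suminf_not_top)
    have "(\<Sum>n. ennreal (r n)) = (\<Sum>n. f n)"
      by (rule suminf_cong) (rule fr[symmetric])
    thus "(\<Sum>n. ennreal (r n)) \<noteq> \<top>"
      using assms by simp
  qed (simp add: r_def)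
  hence "r \<longlonglongrightarrow> 0"
    by (rule summable_LIMSEQ_zero)
  hence "(\<lambda>n. ennreal (r n)) \<longlonglongrightarrow> ennreal 0"
    by (rule tendsto_ennrealI)
  thus ?thesis by (simp add: fr[abs_def])
qed

lemma suminf_swap_ennreal:
  fixes f :: "nat \<Rightarrow> nat \<Rightarrow> ennreal"
  shows "(\<Sum>n. \<Sum>m. f n m) = (\<Sum>m. \<Sum>n. f n m)"
proof -
  have "(\<Sum>n. \<Sum>m. f n m) = (\<integral>\<^sup>+ n. (\<Sum>m. f n m) \<partial>count_space UNIV)"
    by (simp add: nn_integral_count_space_nat)
  also have "\<dots> = (\<Sum>m. \<integral>\<^sup>+ n. f n m \<partial>count_space UNIV)"
    by (rule nn_integral_suminf) simp
  finally show ?thesis by (simp add: nn_integral_count_space_nat)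
qed

text \<open>For \<open>t = k\<close> fewer than \<open>k\<close> terms survive and each is at most
  \<open>k\<close>; for infinite \<open>t\<close> the right-hand side is infinite. This turns
  weighted tail probabilities of a time into its second moment.\<close>

lemma suminf_tail_indicator_le_square:
  "(\<Sum>n. of_nat (Suc n) * indicator {n. enat (Suc n) < t} n) \<le> (ennreal_of_enat t)\<^sup>2"
proof (cases t)
  case (enat k)
  have "(\<Sum>n. of_nat (Suc n) * indicator {n. enat (Suc n) < t} n)
      = (\<Sum>n<k. of_nat (Suc n) * indicator {n. enat (Suc n) < t} n :: ennreal)"
    by (rule suminf_finite) (auto simp: enat)
  also have "\<dots> \<le> (\<Sum>n<k. of_nat k)"
    by (intro sum_mono) (auto simp: enat indicator_def simp del: of_nat_Suc intro!: of_nat_mono)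
  also have "\<dots> = (ennreal_of_enat t)\<^sup>2"
    by (simp add: enat power2_eq_square)
  finally show ?thesis .
qed (simp add: power2_eq_square ennreal_top_mult)

lemma ball_Suc_iff: "(\<forall>j\<in>{1..Suc n}. P j) \<longleftrightarrow> (\<forall>j\<le>n. P (Suc j))"
  unfolding image_Suc_atMost[symmetric] by auto

lemma all_le_Suc_iff: "(\<forall>j\<le>Suc n. P j) \<longleftrightarrow> P 0 \<and> (\<forall>j\<le>n. P (Suc j))"
  using ball_Suc_iff[of n P] by (metis le0 Suc_le_mono not0_implies_Suc)

section \<open>Excursions away from the state \<open>a\<close>\<close>

context markov_rds
begin

text \<open>The transition operator of the chain acting on functions.\<close>

definition step :: "('x \<Rightarrow> ennreal) \<Rightarrow> 'x \<Rightarrow> ennreal"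
  where "step f x = (\<integral>\<^sup>+ \<omega>. f (\<phi> \<omega> 1 x) \<partial>M)"

text \<open>The taboo covers time 0 as well, so the value at \<open>x = a\<close> is 0.\<close>

definition taboo :: "'x \<Rightarrow> 'x set \<Rightarrow> nat \<Rightarrow> 'x \<Rightarrow> ennreal"
  where "taboo a S n x = emeasure M {\<omega> \<in> space M. (\<forall>j\<le>n. \<phi> \<omega> j x \<noteq> a) \<and> \<phi> \<omega> n x \<in> S}"

text \<open>The expected time spent in \<open>S\<close> before hitting \<open>a\<close>. With
  \<open>S = - C\<close> it is the function \<open>V\<close> of the drift argument; with
  \<open>S = UNIV\<close> it is the expected hitting time of \<open>a\<close>.\<close>

definition taboo_green :: "'x \<Rightarrow> 'x set \<Rightarrow> 'x \<Rightarrow> ennreal"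
  where "taboo_green a S x = (\<Sum>n. taboo a S n x)"

lemma step_mono: "(\<And>x. f x \<le> g x) \<Longrightarrow> step f x \<le> step g x"
  unfolding step_def by (intro nn_integral_mono)

lemma step_suminf: "step (\<lambda>y. \<Sum>n. f n y) x = (\<Sum>n. step (f n) x)"
  unfolding step_def by (rule nn_integral_suminf) simp

text \<open>By the Markov property a preliminary step moves the taboo window to the times 1 to
  \<open>Suc n\<close> and leaves the starting state untested. For \<open>x = a\<close> and
  \<open>S = UNIV\<close> the value is therefore the probability that the return time to
  \<open>a\<close> exceeds \<open>Suc n\<close>.\<close>

lemma step_taboo:
  "step (taboo a S n) x =
    emeasure M {\<omega> \<in> space M. (\<forall>j\<in>{1..Suc n}. \<phi> \<omega> j x \<noteq> a) \<and> \<phi> \<omega> (Suc n) x \<in> S}"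
proof -
  define E where "E y = {\<omega> \<in> space M. (\<forall>j\<le>n. \<phi> \<omega> j y \<noteq> a) \<and> \<phi> \<omega> n y \<in> S}" for y
  have E [measurable]: "E y \<in> sets (F_future M \<theta> \<phi> 0)" for y
  proof -
    have "E y = (\<Inter>j\<in>{..n}. (\<lambda>\<omega>. \<phi> \<omega> j y) -` (- {a}) \<inter> space (F_future M \<theta> \<phi> 0))
        \<inter> ((\<lambda>\<omega>. \<phi> \<omega> n y) -` S \<inter> space (F_future M \<theta> \<phi> 0))"
      by (auto simp: E_def)
    also have "\<dots> \<in> sets (F_future M \<theta> \<phi> 0)"
      by (intro sets.Int sets.finite_INT measurable_sets[OF phi_future_measurable]) auto
    finally show ?thesis .
  qed
  have "E y \<in> sets M" for y
    using E sets_F_future_subset by blast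
  hence "step (taboo a S n) x = (\<integral>\<^sup>+ \<omega>. (\<integral>\<^sup>+ \<omega>'. indicator (E (\<phi> \<omega> 1 x)) \<omega>' \<partial>M) \<partial>M)"
    by (simp add: step_def taboo_def E_def)
  also have "\<dots> = (\<integral>\<^sup>+ \<omega>. indicator (E (\<phi> \<omega> 1 x)) (\<theta> 1 \<omega>) \<partial>M)"
    by (rule markov_property_step[symmetric]) simp
  also have "\<dots> = (\<integral>\<^sup>+ \<omega>. indicator {\<omega> \<in> space M.
      (\<forall>j\<in>{1..Suc n}. \<phi> \<omega> j x \<noteq> a) \<and> \<phi> \<omega> (Suc n) x \<in> S} \<omega> \<partial>M)"
  proof (rule nn_integral_cong)
    fix \<omega> assume \<omega>: "\<omega> \<in> space M"
    have shift: "\<phi> \<omega> (Suc j) x = \<phi> (\<theta> 1 \<omega>) j (\<phi> \<omega> 1 x)" for j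
      using phi_cocycle[OF \<omega>, of j 1 x] by simp
    have "(\<forall>j\<in>{1..Suc n}. \<phi> \<omega> j x \<noteq> a) \<longleftrightarrow> (\<forall>j\<le>n. \<phi> \<omega> (Suc j) x \<noteq> a)"
      by (rule ball_Suc_iff)
    thus "indicator (E (\<phi> \<omega> 1 x)) (\<theta> 1 \<omega>) = (indicator {\<omega> \<in> space M.
      (\<forall>j\<in>{1..Suc n}. \<phi> \<omega> j x \<noteq> a) \<and> \<phi> \<omega> (Suc n) x \<in> S} \<omega> :: ennreal)"
      using \<omega> theta_space[OF \<omega>] by (simp add: E_def shift indicator_def del: One_nat_def)
  qed
  also have "\<dots> = emeasure M {\<omega> \<in> space M. (\<forall>j\<in>{1..Suc n}. \<phi> \<omega> j x \<noteq> a) \<and> \<phi> \<omega> (Suc n) x \<in> S}"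
    by (rule nn_integral_indicator) measurable
  finally show ?thesis .
qed

lemma taboo_0: "taboo a S 0 x = (if x = a then 0 else indicator S x)"
proof -
  have "{\<omega> \<in> space M. (\<forall>j\<le>0. \<phi> \<omega> j x \<noteq> a) \<and> \<phi> \<omega> 0 x \<in> S}
    = (if x \<noteq> a \<and> x \<in> S then space M else {})"
    using phi_0 by auto
  thus ?thesis by (simp add: taboo_def emeasure_space_1)
qed

lemma taboo_at: "taboo a S n a = 0"
proof -
  have "{\<omega> \<in> space M. (\<forall>j\<le>n. \<phi> \<omega> j a \<noteq> a) \<and> \<phi> \<omega> n a \<in> S} = {}"
    using phi_0 by blast
  thus ?thesis by (simp only: taboo_def emeasure_empty)
qed

lemma taboo_Suc: "x \<noteq> a \<Longrightarrow> taboo a S (Suc n) x = step (taboo a S n) x"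
proof -
  assume "x \<noteq> a"
  hence "(\<forall>j\<le>Suc n. \<phi> \<omega> j x \<noteq> a) \<longleftrightarrow> (\<forall>j\<in>{1..Suc n}. \<phi> \<omega> j x \<noteq> a)" if "\<omega> \<in> space M" for \<omega>
    using phi_0[OF that, of x]
    unfolding ball_Suc_iff by (simp only: all_le_Suc_iff simp_thms)
  hence "{\<omega> \<in> space M. (\<forall>j\<le>Suc n. \<phi> \<omega> j x \<noteq> a) \<and> \<phi> \<omega> (Suc n) x \<in> S}
    = {\<omega> \<in> space M. (\<forall>j\<in>{1..Suc n}. \<phi> \<omega> j x \<noteq> a) \<and> \<phi> \<omega> (Suc n) x \<in> S}" by blast
  thus ?thesis unfolding step_taboo taboo_def by simp
qed

lemma taboo_mono: "S \<subseteq> T \<Longrightarrow> taboo a S n x \<le> taboo a T n x"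
  unfolding taboo_def by (rule emeasure_mono) (blast, measurable)

lemma taboo_le_1: "taboo a S n x \<le> 1"
  unfolding taboo_def by (rule emeasure_le_1)

lemma taboo_green_at [simp]: "taboo_green a S a = 0"
  by (simp add: taboo_green_def taboo_at)

text \<open>First-step analysis: away from \<open>a\<close> the taboo at time 0 holds automatically,
  so the terms with index at least 1 are one step of the whole series.\<close>

lemma taboo_green_eq:
  assumes "x \<noteq> a"
  shows "taboo_green a S x = indicator S x + step (taboo_green a S) x"
proof -
  have "taboo_green a S x = (\<Sum>n. taboo a S (n + 1) x) + (\<Sum>n<1. taboo a S n x)"
    unfolding taboo_green_def by (rule suminf_offset) simp
  also have "\<dots> = indicator S x + step (taboo_green a S) x"
    using assms by (simp add: taboo_0 taboo_Suc taboo_green_def[abs_def] step_suminf add.commute)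
  finally show ?thesis .
qed

lemma taboo_green_mono: "S \<subseteq> T \<Longrightarrow> taboo_green a S x \<le> taboo_green a T x"
  unfolding taboo_green_def by (intro suminf_le taboo_mono) auto

text \<open>The summands are weighted tails of the return time, and their sum is at most its second
  moment.\<close>

lemma suminf_step_taboo_finite:
  assumes "(\<integral>\<^sup>+ \<omega>. (ennreal_of_enat (return_time \<phi> \<omega> a))\<^sup>2 \<partial>M) < \<infinity>"
  shows "(\<Sum>n. of_nat (Suc n) * step (taboo a UNIV n) a) < \<infinity>"
proof -
  define E where "E n = {\<omega> \<in> space M. \<forall>j\<in>{1..Suc n}. \<phi> \<omega> j a \<noteq> a}" for n
  have [measurable]: "E n \<in> sets M" for n
    unfolding E_def by measurable
  have "(\<Sum>n. of_nat (Suc n) * step (taboo a UNIV n) a)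
      = (\<Sum>n. \<integral>\<^sup>+ \<omega>. of_nat (Suc n) * indicator (E n) \<omega> \<partial>M)"
    by (simp add: step_taboo E_def[symmetric] nn_integral_cmult del: of_nat_Suc One_nat_def)
  also have "\<dots> = (\<integral>\<^sup>+ \<omega>. (\<Sum>n. of_nat (Suc n) * indicator (E n) \<omega>) \<partial>M)"
    by (rule nn_integral_suminf[symmetric]) measurable
  also have "\<dots> \<le> (\<integral>\<^sup>+ \<omega>. (ennreal_of_enat (return_time \<phi> \<omega> a))\<^sup>2 \<partial>M)"
  proof (rule nn_integral_mono)
    fix \<omega>
    have "enat (Suc n) < return_time \<phi> \<omega> a" if "\<omega> \<in> E n" for n
    proof -
      \<comment> \<open>\<open>E n\<close> excludes returns at the times 1 to \<open>Suc n\<close>,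
        so the first possible return is at \<open>n + 2\<close>.\<close>
      have "enat (Suc (Suc n)) \<le> return_time \<phi> \<omega> a"
        unfolding return_time_def
        using that by (intro INF_greatest) (auto simp: E_def not_less_eq_eq)
      thus ?thesis
        using less_le_trans[of "enat (Suc n)" "enat (Suc (Suc n))"] by simp
    qed
    hence "(\<Sum>n. of_nat (Suc n) * indicator (E n) \<omega>)
        \<le> (\<Sum>n. of_nat (Suc n) * indicator {n. enat (Suc n) < return_time \<phi> \<omega> a} n :: ennreal)"
      by (intro suminf_le mult_left_mono) (auto simp: indicator_def simp del: of_nat_Suc)
    also have "\<dots> \<le> (ennreal_of_enat (return_time \<phi> \<omega> a))\<^sup>2"
      by (rule suminf_tail_indicator_le_square)
    finally show "(\<Sum>n. of_nat (Suc n) * indicator (E n) \<omega>) \<le> (ennreal_of_enat (return_time \<phi> \<omega> a))\<^sup>2" .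
  qed
  also have "\<dots> < \<infinity>" by fact
  finally show ?thesis .
qed

lemma step_taboo_green_finite:
  assumes "(\<Sum>n. of_nat (Suc n) * step (taboo a UNIV n) a) < \<infinity>"
  shows "step (taboo_green a UNIV) a < \<infinity>"
proof -
  have "step (taboo_green a UNIV) a = (\<Sum>n. step (taboo a UNIV n) a)"
    unfolding taboo_green_def by (rule step_suminf)
  also have "\<dots> \<le> (\<Sum>n. of_nat (Suc n) * step (taboo a UNIV n) a)"
    by (intro suminf_le) (auto simp: distrib_right)
  finally show ?thesis using assms by (rule le_less_trans)
qed

lemma AE_finite_of_step_finite: "step f x < \<infinity> \<Longrightarrow> AE \<omega> in M. f (\<phi> \<omega> 1 x) < \<infinity>"
  unfolding step_def
  using nn_integral_noteq_infinite[of "\<lambda>\<omega>. f (\<phi> \<omega> 1 x)" M] by (simp add: top.not_eq_extremum)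

text \<open>The states with finite value form a set that the chain almost surely never leaves: off
  \<open>a\<close> one step does not increase the function, and at \<open>a\<close> its mean after
  one step is finite by assumption. The set contains \<open>a\<close>, and from \<open>a\<close>
  irreducibility reaches every state.\<close>

lemma taboo_green_finite:
  assumes irred: "irreducible_chain M \<phi>" and fin: "step (taboo_green a UNIV) a < \<infinity>"
  shows "taboo_green a UNIV x < \<infinity>"
proof -
  let ?S = "{y. taboo_green a UNIV y < \<infinity>}"
  have closed: "AE \<omega> in M. \<phi> \<omega> 1 y \<in> ?S" if "y \<in> ?S" for y
  proof -
    have "step (taboo_green a UNIV) y < \<infinity>"
      using that fin taboo_green_eq[of y a UNIV] by (cases "y = a") auto
    from AE_finite_of_step_finite[OF this] show ?thesis by simp
  qed
  have reach: "\<forall>y\<in>?S. AE \<omega> in M. \<phi> \<omega> n y \<in> ?S" for n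
  proof (induction n)
    case 0
    show ?case using phi_0 by (auto intro!: AE_I2)
  next
    case (Suc n)
    show ?case
    proof
      fix y assume y: "y \<in> ?S"
      \<comment> \<open>The state after one step is random, so the induction hypothesis is needed
        for all states of \<open>?S\<close> outside one null set; countability provides
        this.\<close>
      have "AE \<omega> in M. \<forall>z\<in>?S. \<phi> (\<theta> 1 \<omega>) n z \<in> ?S"
        using Suc by (subst AE_ball_countable) (auto intro!: AE_theta)
      with closed[OF y] AE_space show "AE \<omega> in M. \<phi> \<omega> (Suc n) y \<in> ?S"
      proof eventually_elim
        case (elim \<omega>)
        thus ?case using phi_cocycle[of \<omega> n 1 y] by simp
      qed
    qed
  qed
  obtain n where n: "trans_prob M \<phi> n a x > 0"
    using irred unfolding irreducible_chain_def by blast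
  show ?thesis
  proof (rule ccontr)
    assume "\<not> ?thesis"
    moreover have "AE \<omega> in M. \<phi> \<omega> n a \<in> ?S"
      using reach[of n] by simp
    ultimately have "AE \<omega> in M. \<phi> \<omega> n a \<noteq> x"
      by (auto elim: eventually_mono)
    hence "trans_prob M \<phi> n a x = 0"
      unfolding trans_prob_def by (subst prob_Collect_eq_0) auto
    with n show False by simp
  qed
qed

text \<open>
  Invariance gives \<open>P\<^sub>N(X\<^sub>0,\<dots>,X\<^sub>n \<noteq> a) \<le> P\<^sub>N(X\<^sub>0,\<dots>,X\<^sub>n\<^sub>+\<^sub>1 \<noteq> a) + N{a} P\<^sub>a(\<tau>\<^sub>a > n + 1)\<close>; telescoping
  bounds the left-hand side by a tail of the return time, and summing over \<open>n\<close> yields the second moment.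
\<close>
lemma nn_integral_taboo_green_finite:
  assumes N: "sets N = UNIV" "emeasure N UNIV < \<infinity>"
    and sub: "\<And>f. (\<integral>\<^sup>+ x. f x \<partial>N) \<le> (\<integral>\<^sup>+ x. step f x \<partial>N)"
    and fin: "\<And>x. taboo_green a UNIV x < \<infinity>"
    and deg2: "(\<Sum>n. of_nat (Suc n) * step (taboo a UNIV n) a) < \<infinity>"
  shows "(\<integral>\<^sup>+ x. taboo_green a UNIV x \<partial>N) < \<infinity>"
proof -
  have [measurable]: "f \<in> borel_measurable N" for f :: "'x \<Rightarrow> ennreal"
    using N(1) by (auto simp: measurable_def)
  have spaceN: "space N = UNIV"
    using N(1) sets.sets_into_space[of UNIV N] by auto
  define t where "t n = (\<integral>\<^sup>+ x. taboo a UNIV n x \<partial>N)" for n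
  define G where "G n = step (taboo a UNIV n) a" for n
  define c where "c = emeasure N {a}"
  have c: "c < \<infinity>"
    unfolding c_def using N by (intro le_less_trans[OF emeasure_mono N(2)]) auto
  have rec: "t n \<le> t (Suc n) + c * G n" for n
  proof -
    have "t n \<le> (\<integral>\<^sup>+ x. step (taboo a UNIV n) x \<partial>N)"
      unfolding t_def by (rule sub)
    \<comment> \<open>Off \<open>a\<close> the step gives the next taboo probability. At
      \<open>a\<close> that probability is 0, and the step contributes \<open>G n\<close>.\<close>
    also have "\<dots> = (\<integral>\<^sup>+ x. taboo a UNIV (Suc n) x + G n * indicator {a} x \<partial>N)"
      by (intro nn_integral_cong) (auto simp: taboo_Suc taboo_at G_def indicator_def)
    also have "\<dots> = t (Suc n) + c * G n"
      using N(1) by (simp add: nn_integral_add nn_integral_cmult t_def c_def mult.commute)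
    finally show ?thesis .
  qed
  \<comment> \<open>The tail is written with a condition instead of a shifted index, so that the
    double sum over \<open>n\<close> and \<open>j\<close> can be swapped directly.\<close>
  have iter: "t n \<le> t (n + m) + c * (\<Sum>j<n + m. if n \<le> j then G j else 0)" for n m
  proof (induction m)
    case (Suc m)
    note Suc
    also have "t (n + m) \<le> t (Suc (n + m)) + c * G (n + m)"
      by (rule rec)
    finally show ?case by (simp add: distrib_left add_ac)
  qed simp
  \<comment> \<open>This removes the remainder of the telescoping. Pointwise the integrands are
    terms of a finite series; the bound 1 is integrable because \<open>N\<close> is finite.\<close>
  have "t \<longlonglongrightarrow> (\<integral>\<^sup>+ x. 0 \<partial>N)"
    unfolding t_def
  proof (rule nn_integral_dominated_convergence[where w = "\<lambda>_. 1"])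
    show "AE x in N. (\<lambda>n. taboo a UNIV n x) \<longlonglongrightarrow> 0"
      using fin by (intro AE_I2 ennreal_terms_tendsto_0) (simp add: taboo_green_def)
  qed (use N(2) spaceN in \<open>auto simp: taboo_le_1\<close>)
  hence t0: "t \<longlonglongrightarrow> 0" by simp
  have bound: "t n \<le> c * (\<Sum>j. if n \<le> j then G j else 0)" for n
  proof (rule LIMSEQ_le_const)
    have "(\<lambda>m. t (m + n) + c * (\<Sum>j. if n \<le> j then G j else 0))
        \<longlonglongrightarrow> 0 + c * (\<Sum>j. if n \<le> j then G j else 0)"
      by (intro tendsto_add LIMSEQ_ignore_initial_segment[OF t0] tendsto_const)
    thus "(\<lambda>m. t (m + n) + c * (\<Sum>j. if n \<le> j then G j else 0))
        \<longlonglongrightarrow> c * (\<Sum>j. if n \<le> j then G j else 0)" by simp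
    show "\<exists>N. \<forall>m\<ge>N. t n \<le> t (m + n) + c * (\<Sum>j. if n \<le> j then G j else 0)"
    proof (intro exI allI impI)
      fix m
      have "(\<Sum>j<n + m. if n \<le> j then G j else 0) \<le> (\<Sum>j. if n \<le> j then G j else 0)"
        by (rule sum_le_suminf) auto
      thus "t n \<le> t (m + n) + c * (\<Sum>j. if n \<le> j then G j else 0)"
        using order_trans[OF iter[of n m] add_left_mono[OF mult_left_mono]]
        by (simp add: add.commute[of m n])
    qed
  qed
  have "(\<integral>\<^sup>+ x. taboo_green a UNIV x \<partial>N) = (\<Sum>n. t n)"
    unfolding taboo_green_def t_def by (rule nn_integral_suminf) simp
  also have "\<dots> \<le> (\<Sum>n. c * (\<Sum>j. if n \<le> j then G j else 0))"
    by (intro suminf_le bound) auto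
  also have "\<dots> = c * (\<Sum>j. \<Sum>n. if n \<le> j then G j else 0)"
    by (subst suminf_swap_ennreal[symmetric]) simp
  \<comment> \<open>Each \<open>G j\<close> is counted for \<open>n = 0\<close> to \<open>j\<close>,
    which produces the weight \<open>Suc j\<close> of the second moment.\<close>
  also have "(\<lambda>j. \<Sum>n. if n \<le> j then G j else 0) = (\<lambda>j. of_nat (Suc j) * G j)"
    by (rule ext, subst suminf_finite[of "{.._}"]) auto
  also have "c * (\<Sum>j. of_nat (Suc j) * G j) < \<infinity>"
    using c deg2 by (simp add: G_def ennreal_mult_less_top del: of_nat_Suc)
  finally show ?thesis .
qed

text \<open>An excursion from \<open>a\<close> has finite expected length, so dominated convergence
  makes the expected part of it spent outside a growing finite set tend to 0.\<close>

lemma step_taboo_green_small: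
  assumes "step (taboo_green a UNIV) a < \<infinity>" and "e > 0"
  obtains C where "finite C" "a \<in> C" "step (taboo_green a (- C)) a < e"
proof -
  \<comment> \<open>Increasing finite sets that contain \<open>a\<close> and exhaust the state space
    along its enumeration.\<close>
  define C where "C m = insert a (from_nat ` {..<m} :: 'x set)" for m
  have eq: "step (taboo_green a S) a = (\<integral>\<^sup>+ n. step (taboo a S n) a \<partial>count_space UNIV)" for S
    unfolding taboo_green_def by (simp add: step_suminf nn_integral_count_space_nat)
  \<comment> \<open>The series over the times \<open>n\<close> is read as an integral against
    counting measure, dominated by the case \<open>S = UNIV\<close>.\<close>
  have "(\<lambda>m. \<integral>\<^sup>+ n. step (taboo a (- C m) n) a \<partial>count_space UNIV)
      \<longlonglongrightarrow> (\<integral>\<^sup>+ n. 0 \<partial>(count_space UNIV :: nat measure))"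
  proof (rule nn_integral_dominated_convergence[where w = "\<lambda>n. step (taboo a UNIV n) a"])
    show "AE n in count_space UNIV. (\<lambda>m. step (taboo a (- C m) n) a) \<longlonglongrightarrow> 0"
    proof (rule AE_I2)
      fix n
      let ?E = "\<lambda>m. {\<omega> \<in> space M. (\<forall>j\<in>{1..Suc n}. \<phi> \<omega> j a \<noteq> a) \<and> \<phi> \<omega> (Suc n) a \<in> - C m}"
      have "(\<lambda>m. emeasure M (?E m)) \<longlonglongrightarrow> emeasure M (\<Inter>m. ?E m)"
      proof (rule Lim_emeasure_decseq)
        show "decseq ?E"
          by (auto simp: decseq_def C_def)
        have "?E m \<in> sets M" for m by measurable
        thus "range ?E \<subseteq> sets M" by blast
      qed simp
      moreover have "(\<Inter>m. ?E m) = {}"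
      proof -
        have "y \<in> C (Suc (to_nat y))" for y
          unfolding C_def by (rule insertI2, rule image_eqI[of _ _ "to_nat y"]) auto
        thus ?thesis by blast
      qed
      ultimately show "(\<lambda>m. step (taboo a (- C m) n) a) \<longlonglongrightarrow> 0"
        by (simp add: step_taboo)
    qed
    show "AE n in count_space UNIV. step (taboo a (- C j) n) a \<le> step (taboo a UNIV n) a" for j
      by (intro AE_I2 step_mono taboo_mono) simp
  qed (use assms eq in auto)
  hence "(\<lambda>m. step (taboo_green a (- C m)) a) \<longlonglongrightarrow> 0"
    by (simp add: eq)
  from order_tendstoD(2)[OF this assms(2)]
  obtain m where "step (taboo_green a (- C m)) a < e"
    by (auto simp: eventually_sequentially)
  thus ?thesis by (intro that[of "C m"]) (auto simp: C_def)
qed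

text \<open>Off \<open>a\<close> this is first-step analysis, with equality. At \<open>a\<close>
  both the function and the indicator of \<open>- C\<close> vanish, and only the excursion term
  bounded by \<open>e\<close> remains.\<close>

lemma taboo_green_drift:
  assumes "a \<in> C" "step (taboo_green a (- C)) a \<le> e"
  shows "step (taboo_green a (- C)) x + indicator (- C) x \<le> taboo_green a (- C) x + e * indicator {a} x"
  using assms taboo_green_eq[of x a "- C"] by (cases "x = a") (auto simp: add.commute)

end

section \<open>The attractor seen from time zero\<close>

lemma borel_measurable_countable_valued:
  fixes g :: "'z \<Rightarrow> ennreal"
  assumes D: "countable D" "\<And>\<omega>. \<omega> \<in> space M \<Longrightarrow> Z \<omega> \<in> D"
    and Z: "\<And>z. z \<in> D \<Longrightarrow> {\<omega> \<in> space M. Z \<omega> = z} \<in> sets M"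
  shows "(\<lambda>\<omega>. g (Z \<omega>)) \<in> borel_measurable M"
proof (rule measurableI)
  fix S :: "ennreal set"
  have "(\<lambda>\<omega>. g (Z \<omega>)) -` S \<inter> space M = (\<Union>z\<in>{z\<in>D. g z \<in> S}. {\<omega> \<in> space M. Z \<omega> = z})"
    using D(2) by auto
  also have "\<dots> \<in> sets M"
    using D(1) Z by (intro sets.countable_UN') (auto intro: countable_subset)
  finally show "(\<lambda>\<omega>. g (Z \<omega>)) -` S \<inter> space M \<in> sets M" .
qed simp

lemma (in prob_space) AE_in_set_if_prob_1:
  assumes "\<P>(\<omega> in M. P \<omega>) = 1"
  shows "AE \<omega> in M. P \<omega>"
proof -
  \<comment> \<open>\<open>measure\<close> defaults to 0 outside \<open>sets M\<close>, so
    probability 1 forces measurability.\<close>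
  have "{\<omega> \<in> space M. P \<omega>} \<in> sets M"
    using assms measure_notin_sets by fastforce
  thus ?thesis using assms prob_Collect_eq_1 by blast
qed

lemma countable_finite_sets: "countable {B :: 'x :: countable set. finite B}"
  using countable_Collect_finite by simp

lemma set_valued_eq_sets:
  fixes A :: "'w \<Rightarrow> 'x :: countable set"
  assumes "\<And>x. {\<omega> \<in> space N. x \<in> A \<omega>} \<in> sets N"
  shows "{\<omega> \<in> space N. A \<omega> = B} \<in> sets N"
proof -
  have "{\<omega> \<in> space N. x \<in> A \<omega> \<longleftrightarrow> x \<in> B} \<in> sets N" for x
    using assms[of x] sets.sets_Collect_neg[OF assms[of x]] by (cases "x \<in> B") simp_all
  hence "{\<omega> \<in> space N. \<forall>x. x \<in> A \<omega> \<longleftrightarrow> x \<in> B} \<in> sets N"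
    by (rule sets.sets_Collect_countable_All)
  thus ?thesis by (simp add: set_eq_iff)
qed

text \<open>Here \<open>A\<close> is finite at every point and not only almost everywhere, so that
  its values lie in the countable collection of finite sets and the freezing lemma applies to
  it.\<close>

locale markov_attractor = markov_rds M \<theta> \<phi>
  for M :: "'w measure"
    and \<theta> :: "int \<Rightarrow> 'w \<Rightarrow> 'w"
    and \<phi> :: "'w \<Rightarrow> nat \<Rightarrow> 'x::countable \<Rightarrow> 'x" +
  fixes A :: "'w \<Rightarrow> 'x set"
  assumes A_finite: "\<And>\<omega>. \<omega> \<in> space M \<Longrightarrow> finite (A \<omega>)"
    and A_past: "\<And>x. {\<omega> \<in> space M. x \<in> A \<omega>} \<in> sets (F_past M \<theta> \<phi> 0)"
    and A_invariant: "AE \<omega> in M. \<phi> \<omega> 1 ` A \<omega> = A (\<theta> 1 \<omega>)"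
    and A_attracts: "\<And>x. AE \<omega> in M. \<exists>N. \<forall>n\<ge>N. \<phi> \<omega> n x \<in> A (\<theta> (int n) \<omega>)"
begin

lemma A_eq_past: "{\<omega> \<in> space M. A \<omega> = B} \<in> sets (F_past M \<theta> \<phi> 0)"
  using set_valued_eq_sets[of "F_past M \<theta> \<phi> 0" A B] A_past by simp

lemma A_invariant_iterate: "AE \<omega> in M. \<phi> \<omega> n ` A \<omega> = A (\<theta> (int n) \<omega>)"
proof (induction n)
  case 0
  show ?case
    using phi_0 theta_0 by (auto intro!: AE_I2)
next
  case (Suc n)
  show ?case
    using Suc AE_theta[OF A_invariant, of "int n"] AE_space
  proof eventually_elim
    case (elim \<omega>)
    have "\<phi> \<omega> (Suc n) ` A \<omega> = \<phi> (\<theta> (int n) \<omega>) 1 ` (\<phi> \<omega> n ` A \<omega>)"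
      using phi_cocycle[of \<omega> 1 n] elim(3) by (simp add: image_image)
    also have "\<dots> = A (\<theta> (int (Suc n)) \<omega>)"
      using elim theta_add[of \<omega> 1 "int n"] by simp
    finally show ?case .
  qed
qed

lemma finite_sets_measurable:
  fixes g :: "'x set \<Rightarrow> ennreal"
  shows "(\<lambda>\<omega>. g (A \<omega>)) \<in> borel_measurable M"
  using A_finite A_eq_past sets_F_past_subset
  by (intro borel_measurable_countable_valued[OF countable_finite_sets]) auto

text \<open>Invariance makes the cardinality nonincreasing along almost every orbit. A level
  \<open>k\<close> of positive probability is therefore almost surely kept once reached, and by
  ergodicity almost every orbit ends up below it; stationarity carries the bound back to time
  0.\<close>

lemma A_card_bounded: obtains k where "AE \<omega> in M. card (A \<omega>) \<le> k"
proof -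
  define E where "E k = {\<omega> \<in> space M. card (A \<omega>) \<le> k}" for k
  have E_meas [measurable]: "E k \<in> sets M" for k
  proof -
    have "(\<lambda>\<omega>. of_nat (card (A \<omega>)) :: ennreal) \<in> borel_measurable M"
      by (rule finite_sets_measurable)
    hence "{\<omega> \<in> space M. (of_nat (card (A \<omega>)) :: ennreal) \<le> of_nat k} \<in> sets M"
      by measurable
    thus ?thesis by (simp add: E_def)
  qed
  obtain k where k: "emeasure M (E k) \<noteq> 0"
  proof (rule ccontr)
    assume "\<not> thesis"
    hence "E k \<in> null_sets M" for k using that by (auto simp: null_sets_def)
    hence "(\<Union>k. E k) \<in> null_sets M" by auto
    moreover have "(\<Union>k. E k) = space M" by (auto simp: E_def)
    ultimately show False using emeasure_space_1 by (auto simp: null_sets_def)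
  qed
  \<comment> \<open>Ergodicity is assumed for exactly invariant events. Being eventually in
    \<open>E k\<close> is unaffected by a shift, while \<open>E k\<close> itself is at best
    invariant up to null sets.\<close>
  define E' where "E' = {\<omega> \<in> space M. \<exists>N. \<forall>n\<ge>N. \<theta> (int n) \<omega> \<in> E k}"
  have [measurable]: "{\<omega> \<in> space M. \<theta> (int n) \<omega> \<in> E k} \<in> sets M" for n
    using measurable_sets[OF theta_measurable E_meas, of "int n" k]
    by (simp add: vimage_def Int_def conj_commute)
  have E'_meas: "E' \<in> sets M"
    unfolding E'_def by measurable
  have "\<theta> 1 -` E' \<inter> space M = E'"
  proof -
    have "(\<exists>N. \<forall>n\<ge>N. \<theta> (int n) (\<theta> 1 \<omega>) \<in> E k) \<longleftrightarrow> (\<exists>N. \<forall>n\<ge>N. \<theta> (int n) \<omega> \<in> E k)"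
      if \<omega>: "\<omega> \<in> space M" for \<omega>
    proof -
      have "\<theta> (int n) (\<theta> 1 \<omega>) = \<theta> (int (Suc n)) \<omega>" for n
        using theta_add[OF \<omega>, of "int n" 1] by (simp add: add.commute)
      thus ?thesis
        using eventually_sequentially_Suc[of "\<lambda>n. \<theta> (int n) \<omega> \<in> E k"]
        by (simp add: eventually_sequentially)
    qed
    thus ?thesis using theta_space by (auto simp: E'_def)
  qed
  moreover have "prob E' \<noteq> 0"
  proof -
    have "AE \<omega> in M. \<forall>n. \<phi> \<omega> n ` A \<omega> = A (\<theta> (int n) \<omega>)"
      using A_invariant_iterate by (simp add: AE_all_countable)
    hence "AE \<omega> in M. \<omega> \<in> E k \<longrightarrow> \<omega> \<in> E'"
      using AE_space
    proof eventually_elim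
      case (elim \<omega>)
      have "card (A (\<theta> (int n) \<omega>)) \<le> card (A \<omega>)" for n
        using elim(1) A_finite[OF elim(2)] by (metis card_image_le)
      thus ?case using theta_space by (auto simp: E_def E'_def intro: order_trans)
    qed
    hence "emeasure M (E k) \<le> emeasure M E'"
      using E'_meas by (rule emeasure_mono_AE)
    with k show ?thesis by (auto simp: emeasure_eq_measure measure_le_0_iff)
  qed
  ultimately have "prob E' = 1"
    using theta_ergodic[OF E'_meas] by blast
  hence E'_AE: "AE \<omega> in M. \<exists>N. \<forall>n\<ge>N. \<theta> (int n) \<omega> \<in> E k"
    unfolding E'_def by (rule AE_in_set_if_prob_1)
  \<comment> \<open>By stationarity this sequence is constantly the probability of
    \<open>E k\<close>, so its limit 1 is that probability.\<close>
  have "(\<lambda>n. \<integral>\<^sup>+ \<omega>. indicator (E k) (\<theta> (int n) \<omega>) \<partial>M) \<longlonglongrightarrow> (\<integral>\<^sup>+ \<omega>. 1 \<partial>M)"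
  proof (rule nn_integral_dominated_convergence[where w = "\<lambda>_. 1"])
    show "AE \<omega> in M. (\<lambda>n. indicator (E k) (\<theta> (int n) \<omega>) :: ennreal) \<longlonglongrightarrow> 1"
      using E'_AE
    proof eventually_elim
      case (elim \<omega>)
      hence "\<forall>\<^sub>F n in sequentially. indicator (E k) (\<theta> (int n) \<omega>) = (1 :: ennreal)"
        by (auto simp: eventually_sequentially indicator_def)
      thus ?case by (rule tendsto_eventually)
    qed
    show "(\<lambda>\<omega>. indicator (E k) (\<theta> (int n) \<omega>) :: ennreal) \<in> borel_measurable M" for n
      by (rule measurable_compose[OF theta_measurable]) simp
  qed (auto simp: emeasure_space_1 indicator_def)
  moreover have "(\<integral>\<^sup>+ \<omega>. indicator (E k) (\<theta> (int n) \<omega>) \<partial>M) = emeasure M (E k)" for n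
    by (simp add: nn_integral_theta)
  ultimately have "emeasure M (E k) = 1"
    by (simp add: emeasure_space_1 LIMSEQ_const_iff)
  hence "AE \<omega> in M. \<omega> \<in> E k"
    by (intro AE_prob_1) (simp add: emeasure_eq_measure)
  thus ?thesis by (intro that[of k]) (auto simp: E_def)
qed

lemma image_eq_future:
  assumes "finite B" "finite B'"
  shows "{\<omega> \<in> space M. \<phi> \<omega> n y = y' \<and> \<phi> \<omega> n ` B = B'} \<in> sets (F_future M \<theta> \<phi> 0)"
proof -
  let ?F = "F_future M \<theta> \<phi> 0"
  have *: "{\<omega> \<in> space ?F. \<phi> \<omega> n b \<in> S} \<in> sets ?F" for b S
    using measurable_sets[OF phi_future_measurable, of S n b]
    by (simp add: vimage_def Int_def conj_commute)
  have "{\<omega> \<in> space ?F. \<phi> \<omega> n y \<in> {y'} \<and>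
      ((\<forall>b\<in>B. \<phi> \<omega> n b \<in> B') \<and> (\<forall>b'\<in>B'. \<exists>b\<in>B. \<phi> \<omega> n b \<in> {b'}))} \<in> sets ?F"
    using assms
    by (intro sets.sets_Collect_conj sets.sets_Collect_finite_All sets.sets_Collect_finite_Ex *)
  also have "{\<omega> \<in> space ?F. \<phi> \<omega> n y \<in> {y'} \<and>
      ((\<forall>b\<in>B. \<phi> \<omega> n b \<in> B') \<and> (\<forall>b'\<in>B'. \<exists>b\<in>B. \<phi> \<omega> n b \<in> {b'}))}
    = {\<omega> \<in> space M. \<phi> \<omega> n y = y' \<and> \<phi> \<omega> n ` B = B'}"
    by auto
  finally show ?thesis .
qed

lemma borel_measurable_image_future:
  fixes g :: "'x \<times> 'x set \<Rightarrow> ennreal"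
  assumes "finite B"
  shows "(\<lambda>\<omega>. g (\<phi> \<omega> n y, \<phi> \<omega> n ` B)) \<in> borel_measurable (F_future M \<theta> \<phi> 0)"
  using assms image_eq_future
  by (intro borel_measurable_countable_valued[where D = "UNIV \<times> {B. finite B}"])
     (auto simp: countable_finite_sets)

text \<open>
  The chain started from \<open>x\<close> at time \<open>-k\<close> and observed at time 0. Stationarity moves the comparison
  with the attractor to time 0, where both components are determined by the past.
\<close>
definition pull :: "'x \<Rightarrow> nat \<Rightarrow> 'w \<Rightarrow> 'x"
  where "pull x k \<omega> = \<phi> (\<theta> (- int k) \<omega>) k x"

lemma pull_pair_past:
  "{\<omega> \<in> space M. (pull x k \<omega>, A \<omega>) = z} \<in> sets (F_past M \<theta> \<phi> 0)"
proof -
  let ?F = "F_past M \<theta> \<phi> 0"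
  have "(\<lambda>\<omega>. pull x k \<omega>) -` {fst z} \<inter> space ?F \<in> sets ?F"
    unfolding pull_def by (rule measurable_sets[OF phi_past_measurable]) simp
  from sets.Int[OF this A_eq_past[of "snd z"]] show ?thesis
    by (rule back_subst[of "\<lambda>E. E \<in> sets ?F"]) auto
qed

lemma borel_measurable_pull_pair:
  fixes g :: "'x \<times> 'x set \<Rightarrow> ennreal"
  shows "(\<lambda>\<omega>. g (pull x k \<omega>, A \<omega>)) \<in> borel_measurable M"
  using A_finite
  by (intro borel_measurable_countable_valued[where D = "UNIV \<times> {B. finite B}"]
      subsetD[OF sets_F_past_subset pull_pair_past])
     (auto simp: countable_finite_sets)

lemma pull_theta:
  assumes \<omega>: "\<omega> \<in> space M"
  shows "pull x (n + k) (\<theta> (int n) \<omega>) = \<phi> \<omega> n (pull x k \<omega>)"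
proof -
  have "\<theta> (- int (n + k)) (\<theta> (int n) \<omega>) = \<theta> (- int k) \<omega>"
    using theta_add[OF \<omega>, of "- int (n + k)" "int n"] by simp
  thus ?thesis
    using phi_cocycle[OF theta_space[OF \<omega>], of "- int k" n k x] theta_cancel[OF \<omega>, of "int k"]
    by (simp add: pull_def)
qed

text \<open>The pair at time 0 belongs to the past. After \<open>n\<close> further steps invariance
  writes the attractor as the image of its present value, so the pair moves as a Markov chain driven
  by a fresh \<omega>'.\<close>

lemma pull_markov:
  fixes g :: "'x \<times> 'x set \<Rightarrow> ennreal"
  shows "(\<integral>\<^sup>+ \<omega>. g (pull x (n + k) \<omega>, A \<omega>) \<partial>M) =
    (\<integral>\<^sup>+ \<omega>. (\<integral>\<^sup>+ \<omega>'. g (\<phi> \<omega>' n (pull x k \<omega>), \<phi> \<omega>' n ` A \<omega>) \<partial>M) \<partial>M)"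
proof -
  have "(\<integral>\<^sup>+ \<omega>. g (pull x (n + k) \<omega>, A \<omega>) \<partial>M) =
      (\<integral>\<^sup>+ \<omega>. g (pull x (n + k) (\<theta> (int n) \<omega>), A (\<theta> (int n) \<omega>)) \<partial>M)"
    by (rule nn_integral_theta[symmetric]) (rule borel_measurable_pull_pair)
  also have "\<dots> = (\<integral>\<^sup>+ \<omega>. g (\<phi> \<omega> n (pull x k \<omega>), \<phi> \<omega> n ` A \<omega>) \<partial>M)"
  proof (rule nn_integral_cong_AE)
    show "AE \<omega> in M. g (pull x (n + k) (\<theta> (int n) \<omega>), A (\<theta> (int n) \<omega>)) =
        g (\<phi> \<omega> n (pull x k \<omega>), \<phi> \<omega> n ` A \<omega>)"
      using A_invariant_iterate[of n] AE_space by eventually_elim (simp add: pull_theta)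
  qed
  also have "\<dots> = (\<integral>\<^sup>+ \<omega>. (\<integral>\<^sup>+ \<omega>'. g (\<phi> \<omega>' n (pull x k \<omega>), \<phi> \<omega>' n ` A \<omega>) \<partial>M) \<partial>M)"
    using markov_property[where D = "UNIV \<times> {B. finite B}" and Z = "\<lambda>\<omega>. (pull x k \<omega>, A \<omega>)"
        and f = "\<lambda>z \<omega>. g (\<phi> \<omega> n (fst z), \<phi> \<omega> n ` snd z)"]
    using A_finite pull_pair_past
    by (auto simp: countable_finite_sets borel_measurable_image_future simp del: prod.inject intro!: AE_I2)
  finally show ?thesis .
qed

text \<open>One step maps \<open>A\<close> onto the attractor at the next time, and points that
  coincide afterwards are counted once on the left but several times on the right.\<close>

lemma nn_integral_sum_A_le:
  "(\<integral>\<^sup>+ \<omega>. (\<Sum>y\<in>A \<omega>. f y) \<partial>M) \<le> (\<integral>\<^sup>+ \<omega>. (\<Sum>y\<in>A \<omega>. step f y) \<partial>M)"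
proof -
  have "(\<integral>\<^sup>+ \<omega>. (\<Sum>y\<in>A \<omega>. f y) \<partial>M) = (\<integral>\<^sup>+ \<omega>. (\<integral>\<^sup>+ \<omega>'. (\<Sum>y\<in>\<phi> \<omega>' 1 ` A \<omega>. f y) \<partial>M) \<partial>M)"
    using pull_markov[of "\<lambda>z. \<Sum>y\<in>snd z. f y" _ 1 0] by simp
  also have "\<dots> \<le> (\<integral>\<^sup>+ \<omega>. (\<integral>\<^sup>+ \<omega>'. (\<Sum>y\<in>A \<omega>. f (\<phi> \<omega>' 1 y)) \<partial>M) \<partial>M)"
    by (auto intro!: nn_integral_mono sum_image_le simp: A_finite comp_def
        intro: order_trans[OF sum_image_le])
  also have "\<dots> = (\<integral>\<^sup>+ \<omega>. (\<Sum>y\<in>A \<omega>. step f y) \<partial>M)"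
    by (simp add: step_def nn_integral_sum)
  finally show ?thesis .
qed

text \<open>Campbell's formula: the density is the intensity measure of the random set
  \<open>A\<close>. It turns expected sums over \<open>A\<close> into integrals against a fixed
  measure.\<close>

lemma nn_integral_sum_A_eq:
  "(\<integral>\<^sup>+ y. f y \<partial>density (count_space UNIV) (\<lambda>y. emeasure M {\<omega> \<in> space M. y \<in> A \<omega>})) =
    (\<integral>\<^sup>+ \<omega>. (\<Sum>y\<in>A \<omega>. f y) \<partial>M)"
proof -
  have [measurable]: "{\<omega> \<in> space M. y \<in> A \<omega>} \<in> sets M" for y
    using A_past sets_F_past_subset by blast
  have "(\<integral>\<^sup>+ \<omega>. (\<Sum>y\<in>A \<omega>. f y) \<partial>M) =
      (\<integral>\<^sup>+ \<omega>. (\<integral>\<^sup>+ y. f y * indicator {\<omega> \<in> space M. y \<in> A \<omega>} \<omega> \<partial>count_space UNIV) \<partial>M)"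
  proof (rule nn_integral_cong)
    fix \<omega> assume "\<omega> \<in> space M"
    thus "(\<Sum>y\<in>A \<omega>. f y) = (\<integral>\<^sup>+ y. f y * indicator {\<omega> \<in> space M. y \<in> A \<omega>} \<omega> \<partial>count_space UNIV)"
      using A_finite by (subst nn_integral_count_space'[of "A \<omega>"]) (auto simp: indicator_def)
  qed
  also have "\<dots> = (\<integral>\<^sup>+ y. (\<integral>\<^sup>+ \<omega>. f y * indicator {\<omega> \<in> space M. y \<in> A \<omega>} \<omega> \<partial>M) \<partial>count_space UNIV)"
    by (rule nn_integral_count_space_nn_integral) (auto intro: countableI_type)
  also have "\<dots> = (\<integral>\<^sup>+ y. emeasure M {\<omega> \<in> space M. y \<in> A \<omega>} * f y \<partial>count_space UNIV)"
    by (simp add: nn_integral_cmult mult.commute)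
  finally show ?thesis by (simp add: nn_integral_density)
qed

text \<open>The intensity measure of \<open>A\<close> is finite, as the cardinality is bounded, and
  satisfies the one-sided invariance required by
  \<open>nn_integral_taboo_green_finite\<close>.\<close>

lemma nn_integral_sum_A_finite:
  assumes "\<And>x. taboo_green a UNIV x < \<infinity>"
    and "(\<Sum>n. of_nat (Suc n) * step (taboo a UNIV n) a) < \<infinity>"
  shows "(\<integral>\<^sup>+ \<omega>. (\<Sum>y\<in>A \<omega>. taboo_green a UNIV y) \<partial>M) < \<infinity>"
proof -
  let ?N = "density (count_space UNIV) (\<lambda>y. emeasure M {\<omega> \<in> space M. y \<in> A \<omega>})"
  obtain k where k: "AE \<omega> in M. card (A \<omega>) \<le> k"
    by (rule A_card_bounded)
  have "emeasure ?N UNIV = (\<integral>\<^sup>+ y. 1 \<partial>?N)" by simp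
  also have "\<dots> \<le> (\<integral>\<^sup>+ \<omega>. of_nat k \<partial>M)"
    unfolding nn_integral_sum_A_eq
    using k by (intro nn_integral_mono_AE) (auto elim!: eventually_mono)
  also have "\<dots> < \<infinity>" by (simp add: emeasure_space_1 of_nat_less_top)
  finally show ?thesis
    unfolding nn_integral_sum_A_eq[symmetric]
    by (intro nn_integral_taboo_green_finite assms)
       (auto simp: nn_integral_sum_A_eq nn_integral_sum_A_le)
qed

end

context markov_attractor
begin

section \<open>Drift and merging\<close>

text \<open>By stationarity, the probability that the chain started from \<open>x\<close> at time 0
  is outside the attractor at time \<open>k\<close>.\<close>

definition nonhit_prob :: "'x \<Rightarrow> nat \<Rightarrow> ennreal"
  where "nonhit_prob x k = emeasure M {\<omega> \<in> space M. pull x k \<omega> \<notin> A \<omega>}"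

definition nonmerge_prob :: "nat \<Rightarrow> 'x \<Rightarrow> 'x set \<Rightarrow> ennreal"
  where "nonmerge_prob n y B = emeasure M {\<omega> \<in> space M. \<phi> \<omega> n y \<notin> \<phi> \<omega> n ` B}"

lemma pull_pair_sets: "{\<omega> \<in> space M. P (pull x k \<omega>) (A \<omega>)} \<in> sets M"
proof -
  have "(\<lambda>\<omega>. of_bool (P (pull x k \<omega>) (A \<omega>)) :: ennreal) \<in> borel_measurable M"
    using borel_measurable_pull_pair[of "\<lambda>(y, B). of_bool (P y B)"] by simp
  from measurable_sets[OF this, of "{1}"] show ?thesis
    by (rule back_subst[of "\<lambda>E. E \<in> sets M"]) auto
qed

lemma pull_notin_A_sets [measurable]: "{\<omega> \<in> space M. pull x k \<omega> \<notin> A \<omega>} \<in> sets M"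
  by (rule pull_pair_sets[of "\<lambda>y B. y \<notin> B"])

lemma image_future_sets:
  assumes "finite B"
  shows "{\<omega> \<in> space M. P (\<phi> \<omega> n y) (\<phi> \<omega> n ` B)} \<in> sets (F_future M \<theta> \<phi> 0)"
proof -
  have "(\<lambda>\<omega>. of_bool (P (\<phi> \<omega> n y) (\<phi> \<omega> n ` B)) :: ennreal) \<in> borel_measurable (F_future M \<theta> \<phi> 0)"
    using borel_measurable_image_future[OF assms, of "\<lambda>(y, B). of_bool (P y B)"] by simp
  from measurable_sets[OF this, of "{1}"] show ?thesis
    by (rule back_subst[of "\<lambda>E. E \<in> sets (F_future M \<theta> \<phi> 0)"]) auto
qed

lemma nonmerge_prob_le_1: "nonmerge_prob n y B \<le> 1"
  unfolding nonmerge_prob_def by (rule emeasure_le_1)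

lemma nonmerge_prob_member: "y \<in> B \<Longrightarrow> nonmerge_prob n y B = 0"
  by (simp add: nonmerge_prob_def)

lemma nonhit_prob_add:
  "nonhit_prob x (n + k) = (\<integral>\<^sup>+ \<omega>. nonmerge_prob n (pull x k \<omega>) (A \<omega>) \<partial>M)"
proof -
  have "nonhit_prob x (n + k) = (\<integral>\<^sup>+ \<omega>. indicator {\<omega> \<in> space M. pull x (n + k) \<omega> \<notin> A \<omega>} \<omega> \<partial>M)"
    by (simp add: nonhit_prob_def pull_notin_A_sets)
  also have "\<dots> = (\<integral>\<^sup>+ \<omega>. of_bool (pull x (n + k) \<omega> \<notin> A \<omega>) \<partial>M)"
    by (rule nn_integral_cong) (simp add: indicator_def)
  also have "\<dots> = (\<integral>\<^sup>+ \<omega>. (\<integral>\<^sup>+ \<omega>'. of_bool (\<phi> \<omega>' n (pull x k \<omega>) \<notin> \<phi> \<omega>' n ` A \<omega>) \<partial>M) \<partial>M)"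
    using pull_markov[of "\<lambda>z. of_bool (fst z \<notin> snd z)" x n k] by simp
  also have "\<dots> = (\<integral>\<^sup>+ \<omega>. nonmerge_prob n (pull x k \<omega>) (A \<omega>) \<partial>M)"
  proof (rule nn_integral_cong)
    fix \<omega> assume \<omega>: "\<omega> \<in> space M"
    let ?H = "{\<omega>' \<in> space M. \<phi> \<omega>' n (pull x k \<omega>) \<notin> \<phi> \<omega>' n ` A \<omega>}"
    have "?H \<in> sets M"
      using image_future_sets[OF A_finite[OF \<omega>], of "\<lambda>y B. y \<notin> B"] sets_F_future_subset by blast
    hence "nonmerge_prob n (pull x k \<omega>) (A \<omega>) = (\<integral>\<^sup>+ \<omega>'. indicator ?H \<omega>' \<partial>M)"
      by (simp add: nonmerge_prob_def)
    also have "\<dots> = (\<integral>\<^sup>+ \<omega>'. of_bool (\<phi> \<omega>' n (pull x k \<omega>) \<notin> \<phi> \<omega>' n ` A \<omega>) \<partial>M)"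
      by (rule nn_integral_cong) (simp add: indicator_def)
    finally show "(\<integral>\<^sup>+ \<omega>'. of_bool (\<phi> \<omega>' n (pull x k \<omega>) \<notin> \<phi> \<omega>' n ` A \<omega>) \<partial>M) =
        nonmerge_prob n (pull x k \<omega>) (A \<omega>)" ..
  qed
  finally show ?thesis .
qed

text \<open>On the event \<open>A \<omega> = B\<close> attraction and invariance force
  \<open>y\<close> to merge with \<open>B\<close>. That event is past and merging is future, so the
  product of the two probabilities tends to 0, and the first factor is a positive constant.\<close>

lemma nonmerge_prob_eventually_less:
  assumes "finite B" and pos: "emeasure M {\<omega> \<in> space M. A \<omega> = B} > 0" and "e > 0"
  shows "\<forall>\<^sub>F n in sequentially. nonmerge_prob n y B < e"
proof -
  let ?E = "{\<omega> \<in> space M. A \<omega> = B}"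
  let ?H = "\<lambda>n. {\<omega> \<in> space M. \<phi> \<omega> n y \<notin> \<phi> \<omega> n ` B}"
  have H: "?H n \<in> sets (F_future M \<theta> \<phi> 0)" "?H n \<in> sets M" for n
    using image_future_sets[OF assms(1), of "\<lambda>y B. y \<notin> B"] sets_F_future_subset by auto
  have E [measurable]: "?E \<in> sets M"
    using A_eq_past sets_F_past_subset by blast
  have "(\<lambda>n. \<integral>\<^sup>+ \<omega>. indicator ?E \<omega> * indicator (?H n) \<omega> \<partial>M) \<longlonglongrightarrow> (\<integral>\<^sup>+ \<omega>. 0 \<partial>M)"
  proof (rule nn_integral_dominated_convergence[where w = "\<lambda>_. 1"])
    have "AE \<omega> in M. \<forall>n. \<phi> \<omega> n ` A \<omega> = A (\<theta> (int n) \<omega>)"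
      using A_invariant_iterate by (simp add: AE_all_countable)
    with A_attracts[of y]
    show "AE \<omega> in M. (\<lambda>n. indicator ?E \<omega> * indicator (?H n) \<omega> :: ennreal) \<longlonglongrightarrow> 0"
    proof eventually_elim
      case (elim \<omega>)
      then obtain N where "\<forall>n\<ge>N. \<phi> \<omega> n y \<in> \<phi> \<omega> n ` A \<omega>" by auto
      hence "\<forall>\<^sub>F n in sequentially. indicator ?E \<omega> * indicator (?H n) \<omega> = (0 :: ennreal)"
        by (auto simp: eventually_sequentially indicator_def)
      thus ?case by (rule tendsto_eventually)
    qed
    show "(\<lambda>\<omega>. indicator ?E \<omega> * indicator (?H n) \<omega> :: ennreal) \<in> borel_measurable M" for n
      using H(2)[of n] E by (intro borel_measurable_times_ennreal borel_measurable_indicator)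
  qed (auto simp: emeasure_space_1 indicator_def)
  moreover have "(\<integral>\<^sup>+ \<omega>. indicator ?E \<omega> * indicator (?H n) \<omega> \<partial>M) = emeasure M ?E * nonmerge_prob n y B" for n
    using H[of n] by (subst nn_integral_past_future[OF A_eq_past]) (auto simp: nonmerge_prob_def)
  ultimately have lim: "(\<lambda>n. emeasure M ?E * nonmerge_prob n y B) \<longlonglongrightarrow> 0" by simp
  have "0 < emeasure M ?E * e"
    using pos assms(3) by (simp add: ennreal_zero_less_mult_iff)
  from order_tendstoD(2)[OF lim this] show ?thesis
  proof (rule eventually_mono)
    fix n assume "emeasure M ?E * nonmerge_prob n y B < emeasure M ?E * e"
    thus "nonmerge_prob n y B < e"
      using mult_left_mono[of e "nonmerge_prob n y B" "emeasure M ?E"] by (auto simp: not_le[symmetric])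
  qed
qed

lemma nonmerge_prob_uniform:
  assumes "finite C" "e > 0"
  obtains N where "AE \<omega> in M. A \<omega> \<subseteq> C \<longrightarrow> (\<forall>y\<in>C. nonmerge_prob N y (A \<omega>) < e)"
proof -
  \<comment> \<open>The values that \<open>A\<close> takes with positive probability inside
    \<open>C\<close>. There are finitely many, so one time serves them all; the other subsets of
    \<open>C\<close> are excluded by a null set.\<close>
  let ?\<B> = "{B \<in> Pow C. emeasure M {\<omega> \<in> space M. A \<omega> = B} > 0}"
  have "\<forall>\<^sub>F n in sequentially. \<forall>B\<in>?\<B>. \<forall>y\<in>C. nonmerge_prob n y B < e"
    using assms
    by (intro eventually_ball_finite ballI nonmerge_prob_eventually_less) (auto intro: finite_subset)
  then obtain N where N: "\<And>B y. B \<in> ?\<B> \<Longrightarrow> y \<in> C \<Longrightarrow> nonmerge_prob N y B < e"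
    unfolding eventually_sequentially by blast
  have "AE \<omega> in M. \<forall>B\<in>Pow C - ?\<B>. A \<omega> \<noteq> B"
  proof (subst AE_ball_countable)
    show "countable (Pow C - ?\<B>)"
      using assms by (auto intro: countable_finite)
    show "\<forall>B\<in>Pow C - ?\<B>. AE \<omega> in M. A \<omega> \<noteq> B"
    proof
      fix B assume "B \<in> Pow C - ?\<B>"
      hence "{\<omega> \<in> space M. \<not> A \<omega> \<noteq> B} \<in> null_sets M"
        using A_eq_past[of B] sets_F_past_subset by (auto simp: null_sets_def)
      thus "AE \<omega> in M. A \<omega> \<noteq> B" by (rule AE_I') blast
    qed
  qed
  hence "AE \<omega> in M. A \<omega> \<subseteq> C \<longrightarrow> (\<forall>y\<in>C. nonmerge_prob N y (A \<omega>) < e)"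
    by (rule eventually_mono) (use N in blast)
  thus ?thesis by (rule that)
qed

text \<open>Two recursions are combined. The drift gives
  \<open>w (Suc k) + p k / 2 \<le> w k + c k\<close>, which bounds the sum of \<open>p\<close> by
  that of \<open>c\<close>; merging gives \<open>p (N + k) + c k / 2 \<le> p k\<close>, which bounds
  the sum of \<open>c\<close> by \<open>2 * N\<close>.\<close>

lemma suminf_nonhit_prob_le:
  fixes V :: "'x \<Rightarrow> ennreal"
  assumes drift: "\<And>y. step V y + indicator (- C) y \<le> V y + ennreal (1/2) * indicator {a} y"
    and N: "AE \<omega> in M. A \<omega> \<subseteq> C \<longrightarrow> (\<forall>y\<in>C. nonmerge_prob N y (A \<omega>) < ennreal (1/2))"
  shows "(\<Sum>k. nonhit_prob x k) \<le> 2 * (V x + (\<integral>\<^sup>+ \<omega>. (\<Sum>y\<in>A \<omega>. V y) \<partial>M) + 2 * of_nat N)"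
proof -
  let ?h = "ennreal (1/2)"
  have half: "?h + ?h = 1"
    by (subst ennreal_plus[symmetric]) auto
  have double_half: "2 * (?h * z) = z" for z
    by (simp only: mult_2 distrib_right[symmetric] half mult_1)
  \<comment> \<open>The potential of the tuple, switched off once \<open>y\<close> has merged with
    \<open>B\<close>.\<close>
  define W where "W y B = of_bool (y \<notin> B) * (\<Sum>z\<in>insert y B. V z)" for y B
  \<comment> \<open>On \<open>near\<close> the tuple is unmerged and no point of it supplies the
    drift available off \<open>C\<close>. \<open>far\<close> is the whole unmerged event and
    contains \<open>near\<close>.\<close>
  define near where "near k = {\<omega> \<in> space M. pull x k \<omega> \<notin> A \<omega> \<and> pull x k \<omega> \<in> C \<and> A \<omega> \<subseteq> C}" for k
  define far where "far k = {\<omega> \<in> space M. pull x k \<omega> \<notin> A \<omega>}" for k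
  have sets [measurable]: "near k \<in> sets M" "far k \<in> sets M" for k
    unfolding near_def far_def
    by (rule pull_pair_sets[of "\<lambda>y B. y \<notin> B \<and> y \<in> C \<and> B \<subseteq> C"] pull_notin_A_sets)+
  define c where "c k = emeasure M (near k)" for k
  define p where "p k = nonhit_prob x k" for k
  have p: "p k = emeasure M (far k)" for k
    by (simp add: p_def nonhit_prob_def far_def)
  define w where "w k = (\<integral>\<^sup>+ \<omega>. W (pull x k \<omega>) (A \<omega>) \<partial>M)" for k
  have W_meas [measurable]: "(\<lambda>\<omega>. W (pull x k \<omega>) (A \<omega>)) \<in> borel_measurable M" for k
    using borel_measurable_pull_pair[of "\<lambda>z. W (fst z) (snd z)"] by simp
  \<comment> \<open>Bounds the mean of \<open>W\<close> after one step: merged points stay merged,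
    so the present indicator dominates the next one, and points that coincide after the step only
    lower the sum.\<close>
  define W' where "W' y B = of_bool (y \<notin> B) * (\<Sum>z\<in>insert y B. step V z)" for y B
  have W'_meas [measurable]: "(\<lambda>\<omega>. W' (pull x k \<omega>) (A \<omega>)) \<in> borel_measurable M" for k
    using borel_measurable_pull_pair[of "\<lambda>z. W' (fst z) (snd z)"] by simp

  have w_Suc: "w (Suc k) + ?h * p k \<le> w k + c k" for k
  proof -
    have "w (Suc k) = (\<integral>\<^sup>+ \<omega>. (\<integral>\<^sup>+ \<omega>'. W (\<phi> \<omega>' 1 (pull x k \<omega>)) (\<phi> \<omega>' 1 ` A \<omega>) \<partial>M) \<partial>M)"
      using pull_markov[of "\<lambda>z. W (fst z) (snd z)" x 1 k] by (simp add: w_def)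
    also have "\<dots> \<le> (\<integral>\<^sup>+ \<omega>. W' (pull x k \<omega>) (A \<omega>) \<partial>M)"
    proof (rule nn_integral_mono)
      fix \<omega> assume "\<omega> \<in> space M"
      hence fin: "finite (insert (pull x k \<omega>) (A \<omega>))" using A_finite by simp
      have "(\<integral>\<^sup>+ \<omega>'. W (\<phi> \<omega>' 1 (pull x k \<omega>)) (\<phi> \<omega>' 1 ` A \<omega>) \<partial>M)
          \<le> (\<integral>\<^sup>+ \<omega>'. of_bool (pull x k \<omega> \<notin> A \<omega>) * (\<Sum>z\<in>insert (pull x k \<omega>) (A \<omega>). V (\<phi> \<omega>' 1 z)) \<partial>M)"
        unfolding W_def image_insert[symmetric]
        using sum_image_le[OF fin, of V] by (intro nn_integral_mono mult_mono) (auto simp: comp_def)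
      also have "\<dots> = W' (pull x k \<omega>) (A \<omega>)"
        using nn_integral_sum[of "insert (pull x k \<omega>) (A \<omega>)" "\<lambda>z \<omega>'. V (\<phi> \<omega>' 1 z)" M]
        by (simp add: W'_def step_def nn_integral_cmult)
      finally show "(\<integral>\<^sup>+ \<omega>'. W (\<phi> \<omega>' 1 (pull x k \<omega>)) (\<phi> \<omega>' 1 ` A \<omega>) \<partial>M) \<le> W' (pull x k \<omega>) (A \<omega>)" .
    qed
    finally have 1: "w (Suc k) \<le> (\<integral>\<^sup>+ \<omega>. W' (pull x k \<omega>) (A \<omega>) \<partial>M)" .
    have "(\<integral>\<^sup>+ \<omega>. W' (pull x k \<omega>) (A \<omega>) \<partial>M) + ?h * p k
        = (\<integral>\<^sup>+ \<omega>. W' (pull x k \<omega>) (A \<omega>) + ?h * indicator (far k) \<omega> \<partial>M)"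
      by (simp add: nn_integral_add nn_integral_cmult p)
    also have "\<dots> \<le> (\<integral>\<^sup>+ \<omega>. W (pull x k \<omega>) (A \<omega>) + indicator (near k) \<omega> \<partial>M)"
    proof (rule nn_integral_mono)
      fix \<omega> assume \<omega>: "\<omega> \<in> space M"
      show "W' (pull x k \<omega>) (A \<omega>) + ?h * indicator (far k) \<omega> \<le> W (pull x k \<omega>) (A \<omega>) + indicator (near k) \<omega>"
      proof (cases "pull x k \<omega> \<in> A \<omega>")
        case False
        let ?B = "insert (pull x k \<omega>) (A \<omega>)"
        have fin: "finite ?B" using A_finite[OF \<omega>] by simp
        \<comment> \<open>Either the whole tuple lies in \<open>C\<close>, or some point outside
          \<open>C\<close> provides a decrease of 1.\<close>
        have "1 \<le> indicator (near k) \<omega> + (\<Sum>z\<in>?B. indicator (- C) z :: ennreal)"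
        proof (cases "?B \<subseteq> C")
          case True
          thus ?thesis using \<omega> False by (auto simp: near_def intro: add_increasing2)
        next
          case False
          then obtain z where z: "z \<in> ?B" "z \<notin> C" by blast
          have "(1 :: ennreal) = (\<Sum>z\<in>{z}. indicator (- C) z)" using z by simp
          also have "\<dots> \<le> (\<Sum>z\<in>?B. indicator (- C) z)"
            using z fin by (intro sum_mono2) auto
          finally show ?thesis by (rule add_increasing[OF zero_le])
        qed
        hence "(\<Sum>z\<in>?B. step V z) + 1
            \<le> (\<Sum>z\<in>?B. step V z) + (indicator (near k) \<omega> + (\<Sum>z\<in>?B. indicator (- C) z))"
          by (rule add_left_mono)
        also have "\<dots> = (\<Sum>z\<in>?B. step V z + indicator (- C) z) + indicator (near k) \<omega>"
          by (simp only: sum.distrib ac_simps)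
        also have "\<dots> \<le> (\<Sum>z\<in>?B. V z + ?h * indicator {a} z) + indicator (near k) \<omega>"
          by (intro add_right_mono sum_mono drift)
        \<comment> \<open>The elements of \<open>?B\<close> are distinct, so the state \<open>a\<close> contributes only once.\<close>
        also have "\<dots> \<le> ((\<Sum>z\<in>?B. V z) + ?h) + indicator (near k) \<omega>"
        proof -
          have "(\<Sum>z\<in>?B. ?h * indicator {a} z) = (\<Sum>z\<in>?B \<inter> {a}. ?h)"
            by (intro sum.mono_neutral_cong_right) (use fin in \<open>auto simp: indicator_def\<close>)
          also have "\<dots> \<le> (\<Sum>z\<in>{a}. ?h)"
            by (rule sum_mono2) auto
          finally have "(\<Sum>z\<in>?B. ?h * indicator {a} z) \<le> ?h" by simp
          thus ?thesis unfolding sum.distrib by (intro add_right_mono add_left_mono)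
        qed
        \<comment> \<open>The decrease 1 is split into two halves: one pays for the state
          \<open>a\<close>, the other is the gain that remains.\<close>
        finally have "?h + ((\<Sum>z\<in>?B. step V z) + ?h) \<le> ?h + ((\<Sum>z\<in>?B. V z) + indicator (near k) \<omega>)"
          unfolding half[symmetric] by (simp only: ac_simps)
        hence "(\<Sum>z\<in>?B. step V z) + ?h \<le> (\<Sum>z\<in>?B. V z) + indicator (near k) \<omega>"
          by (simp add: ennreal_add_left_cancel_le)
        thus ?thesis using False \<omega> by (simp add: W_def W'_def far_def)
      qed (simp add: W_def W'_def far_def)
    qed
    also have "\<dots> = w k + c k"
      by (simp add: nn_integral_add w_def c_def)
    finally show ?thesis
      using 1 by (meson add_right_mono order_trans)
  qed

  \<comment> \<open>Given a configuration in \<open>near k\<close>, at least half of the probability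
    has merged \<open>N\<close> steps later; any other unmerged configuration contributes at most
    its own probability.\<close>
  have p_add: "p (N + k) + ?h * c k \<le> p k" for k
  proof -
    have meas [measurable]: "(\<lambda>\<omega>. nonmerge_prob N (pull x k \<omega>) (A \<omega>)) \<in> borel_measurable M"
      using borel_measurable_pull_pair[of "\<lambda>z. nonmerge_prob N (fst z) (snd z)"] by simp
    have "p (N + k) + ?h * c k =
        (\<integral>\<^sup>+ \<omega>. nonmerge_prob N (pull x k \<omega>) (A \<omega>) + ?h * indicator (near k) \<omega> \<partial>M)"
      by (simp add: nn_integral_add nn_integral_cmult p_def nonhit_prob_add c_def)
    also have "\<dots> \<le> (\<integral>\<^sup>+ \<omega>. indicator (far k) \<omega> \<partial>M)"
    proof (rule nn_integral_mono_AE)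
      show "AE \<omega> in M. nonmerge_prob N (pull x k \<omega>) (A \<omega>) + ?h * indicator (near k) \<omega> \<le> indicator (far k) \<omega>"
        using N AE_space
      proof eventually_elim
        case (elim \<omega>)
        show ?case
        proof (cases "\<omega> \<in> near k")
          case True
          hence "nonmerge_prob N (pull x k \<omega>) (A \<omega>) \<le> ?h"
            using elim by (auto simp: near_def intro: less_imp_le)
          hence "nonmerge_prob N (pull x k \<omega>) (A \<omega>) + ?h \<le> 1"
            unfolding half[symmetric] by (rule add_right_mono)
          thus ?thesis using True by (auto simp: near_def far_def)
        next
          case False
          thus ?thesis
            using elim(2) nonmerge_prob_le_1 nonmerge_prob_member by (auto simp: far_def indicator_def)
        qed
      qed
    qed
    also have "\<dots> = p k" by (simp add: p)
    finally show ?thesis .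
  qed

  have c_sum: "(\<Sum>k<n. c k) \<le> 2 * of_nat N" for n
  proof -
    have p_le_1: "p k \<le> 1" for k
      unfolding p by (rule emeasure_le_1)
    have fin: "(\<Sum>k<n. p (N + k)) < top"
      using sum_bounded_above[of "{..<n}" "\<lambda>k. p (N + k)" 1] p_le_1
      by (simp add: le_less_trans[OF _ of_nat_less_top])
    have "(\<Sum>k<n. p (N + k)) + ?h * (\<Sum>k<n. c k) = (\<Sum>k<n. p (N + k) + ?h * c k)"
      by (simp add: sum.distrib sum_distrib_left)
    also have "\<dots> \<le> (\<Sum>k<n. p k)"
      by (intro sum_mono p_add)
    also have "\<dots> \<le> (\<Sum>k<N + n. p k)"
      by (intro sum_mono2) auto
    also have "\<dots> = (\<Sum>k<N. p k) + (\<Sum>k<n. p (N + k))"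
      by (induction n) (simp_all add: add.assoc)
    also have "\<dots> \<le> of_nat N + (\<Sum>k<n. p (N + k))"
      using sum_bounded_above[of "{..<N}" p 1] p_le_1 by (intro add_right_mono) simp
    \<comment> \<open>The shifted block occurs on both sides and cancels because it is finite. The
      \<open>N\<close> initial terms are left, each at most 1.\<close>
    finally have "?h * (\<Sum>k<n. c k) \<le> of_nat N"
      using fin by (subst (asm) add.commute[of "of_nat N"])
        (metis ennreal_add_left_cancel_le infinity_ennreal_def less_irrefl)
    hence "2 * (?h * (\<Sum>k<n. c k)) \<le> 2 * of_nat N"
      by (rule mult_left_mono) simp
    thus ?thesis by (simp only: double_half)
  qed

  have iter: "?h * (\<Sum>k<n. p k) + w n \<le> w 0 + (\<Sum>k<n. c k)" for n
  proof (induction n)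
    case (Suc n)
    have "?h * (\<Sum>k<Suc n. p k) + w (Suc n) = ?h * (\<Sum>k<n. p k) + (w (Suc n) + ?h * p n)"
      by (simp add: distrib_left ac_simps)
    also have "\<dots> \<le> ?h * (\<Sum>k<n. p k) + (w n + c n)"
      by (intro add_left_mono w_Suc)
    also have "\<dots> = (?h * (\<Sum>k<n. p k) + w n) + c n"
      by (simp only: ac_simps)
    also have "\<dots> \<le> (w 0 + (\<Sum>k<n. c k)) + c n"
      by (intro add_right_mono Suc)
    finally show ?case by (simp add: add.assoc)
  qed simp
  have w_0: "w 0 \<le> V x + (\<integral>\<^sup>+ \<omega>. (\<Sum>y\<in>A \<omega>. V y) \<partial>M)"
  proof -
    have "w 0 \<le> (\<integral>\<^sup>+ \<omega>. V x + (\<Sum>y\<in>A \<omega>. V y) \<partial>M)"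
      unfolding w_def
    proof (rule nn_integral_mono)
      fix \<omega> assume \<omega>: "\<omega> \<in> space M"
      have "pull x 0 \<omega> = x"
        using theta_space[OF \<omega>] by (simp add: pull_def phi_0)
      thus "W (pull x 0 \<omega>) (A \<omega>) \<le> V x + (\<Sum>y\<in>A \<omega>. V y)"
        using A_finite[OF \<omega>] by (simp add: W_def)
    qed
    also have "\<dots> = V x + (\<integral>\<^sup>+ \<omega>. (\<Sum>y\<in>A \<omega>. V y) \<partial>M)"
      using finite_sets_measurable[of "sum V"] by (simp add: nn_integral_add emeasure_space_1)
    finally show ?thesis .
  qed
  show ?thesis
  proof (rule suminf_le_const)
    show "(\<Sum>k<n. nonhit_prob x k) \<le> 2 * (V x + (\<integral>\<^sup>+ \<omega>. (\<Sum>y\<in>A \<omega>. V y) \<partial>M) + 2 * of_nat N)" for n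
    proof -
      have "?h * (\<Sum>k<n. p k) \<le> w 0 + (\<Sum>k<n. c k)"
        using iter[of n] by (rule order_trans[rotated]) simp
      also have "\<dots> \<le> V x + (\<integral>\<^sup>+ \<omega>. (\<Sum>y\<in>A \<omega>. V y) \<partial>M) + 2 * of_nat N"
        by (intro add_mono w_0 c_sum)
      finally have "2 * (?h * (\<Sum>k<n. p k)) \<le> 2 * (V x + (\<integral>\<^sup>+ \<omega>. (\<Sum>y\<in>A \<omega>. V y) \<partial>M) + 2 * of_nat N)"
        by (rule mult_left_mono) simp
      thus ?thesis by (simp only: double_half p_def)
    qed
  qed simp
qed

text \<open>The chain is outside the attractor at every time before the hitting time, so the hitting
  time is at most the number of times spent outside.\<close>

lemma nn_integral_hitting_time_le:
  "(\<integral>\<^sup>+ \<omega>. ennreal_of_enat (hitting_time \<theta> \<phi> A \<omega> x) \<partial>M) \<le> (\<Sum>k. nonhit_prob x k)"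
proof -
  define E where "E k = {\<omega> \<in> space M. \<phi> \<omega> k x \<notin> A (\<theta> (int k) \<omega>)}" for k
  \<comment> \<open>In this form the event is a preimage under \<open>\<theta> (int k)\<close>,
    which measure preservation moves to time 0.\<close>
  have E_eq: "E k = {\<omega> \<in> space M. pull x k (\<theta> (int k) \<omega>) \<notin> A (\<theta> (int k) \<omega>)}" for k
    using pull_theta[of _ x k 0] phi_0 theta_space by (auto simp: E_def pull_def)
  have E_meas [measurable]: "E k \<in> sets M" for k
  proof -
    have "\<theta> (int k) -` {\<omega> \<in> space M. pull x k \<omega> \<notin> A \<omega>} \<inter> space M \<in> sets M"
      by (rule measurable_sets[OF theta_measurable pull_notin_A_sets])
    also have "\<theta> (int k) -` {\<omega> \<in> space M. pull x k \<omega> \<notin> A \<omega>} \<inter> space M = E k"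
      using theta_space by (auto simp: E_eq)
    finally show ?thesis .
  qed
  have "(\<integral>\<^sup>+ \<omega>. ennreal_of_enat (hitting_time \<theta> \<phi> A \<omega> x) \<partial>M) \<le> (\<integral>\<^sup>+ \<omega>. (\<Sum>k. indicator (E k) \<omega>) \<partial>M)"
  proof (rule nn_integral_mono)
    fix \<omega> assume \<omega>: "\<omega> \<in> space M"
    let ?T = "hitting_time \<theta> \<phi> A \<omega> x"
    have E: "\<omega> \<in> E k" if "enat k < ?T" for k
    proof (rule ccontr)
      assume "\<omega> \<notin> E k"
      hence "?T \<le> enat k"
        using \<omega> unfolding hitting_time_def E_def by (intro INF_lower) auto
      with that show False by simp
    qed
    \<comment> \<open>Stated for every \<open>n\<close> up to the hitting time, so that an infinite
      hitting time makes the series exceed all \<open>n\<close>.\<close>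
    have bound: "of_nat n \<le> (\<Sum>k. indicator (E k) \<omega> :: ennreal)" if "enat n \<le> ?T" for n
    proof -
      have "\<omega> \<in> E k" if "k < n" for k
        using that \<open>enat n \<le> ?T\<close> by (intro E) (rule less_le_trans[of _ "enat n"], simp)
      hence "(of_nat n :: ennreal) = (\<Sum>k<n. indicator (E k) \<omega>)"
        by simp
      also have "\<dots> \<le> (\<Sum>k. indicator (E k) \<omega>)"
        by (rule sum_le_suminf) auto
      finally show ?thesis .
    qed
    show "ennreal_of_enat ?T \<le> (\<Sum>k. indicator (E k) \<omega>)"
    proof (cases ?T)
      case (enat n)
      thus ?thesis using bound[of n] by simp
    next
      case infinity
      show ?thesis
      proof (rule ccontr)
        assume "\<not> ?thesis"
        then obtain n where "(\<Sum>k. indicator (E k) \<omega> :: ennreal) < of_nat n"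
          using ennreal_Ex_less_of_nat by (auto simp: infinity less_top not_le)
        with bound[of n] infinity show False by (simp add: not_le[symmetric])
      qed
    qed
  qed
  also have "\<dots> = (\<Sum>k. emeasure M (E k))"
    by (simp add: nn_integral_suminf)
  also have "\<dots> = (\<Sum>k. nonhit_prob x k)"
    unfolding E_eq nonhit_prob_def by (intro suminf_cong emeasure_theta pull_notin_A_sets)
  finally show ?thesis .
qed

end

section \<open>Stationary distributions and random attractors\<close>

lemma sum_le_nn_integral_count_space:
  fixes f :: "'x \<Rightarrow> ennreal"
  assumes "finite F"
  shows "sum f F \<le> (\<integral>\<^sup>+ x. f x \<partial>count_space UNIV)"
proof -
  have "sum f F = (\<integral>\<^sup>+ x. f x * indicator F x \<partial>count_space UNIV)"
    using assms by (subst nn_integral_count_space'[of F]) (auto simp: indicator_def)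
  also have "\<dots> \<le> (\<integral>\<^sup>+ x. f x \<partial>count_space UNIV)"
    by (intro nn_integral_mono) (auto simp: indicator_def)
  finally show ?thesis .
qed

context markov_rds
begin

lemma step_eq_trans_prob:
  "step f x = (\<integral>\<^sup>+ y. f y * ennreal (trans_prob M \<phi> 1 x y) \<partial>count_space UNIV)"
proof -
  let ?E = "\<lambda>y. {\<omega> \<in> space M. \<phi> \<omega> 1 x = y}"
  have [measurable]: "?E y \<in> sets M" for y
    by measurable
  have "step f x = (\<integral>\<^sup>+ \<omega>. (\<integral>\<^sup>+ y. f y * indicator (?E y) \<omega> \<partial>count_space UNIV) \<partial>M)"
    unfolding step_def
  proof (rule nn_integral_cong)
    fix \<omega> assume "\<omega> \<in> space M"
    thus "f (\<phi> \<omega> 1 x) = (\<integral>\<^sup>+ y. f y * indicator (?E y) \<omega> \<partial>count_space UNIV)"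
      by (subst nn_integral_count_space'[of "{\<phi> \<omega> 1 x}"]) (auto simp: indicator_def)
  qed
  also have "\<dots> = (\<integral>\<^sup>+ y. (\<integral>\<^sup>+ \<omega>. f y * indicator (?E y) \<omega> \<partial>M) \<partial>count_space UNIV)"
    by (rule nn_integral_count_space_nn_integral) (auto intro: countableI_type)
  also have "\<dots> = (\<integral>\<^sup>+ y. f y * ennreal (trans_prob M \<phi> 1 x y) \<partial>count_space UNIV)"
    by (simp add: nn_integral_cmult trans_prob_def emeasure_eq_measure)
  finally show ?thesis .
qed

text \<open>Stationarity is given state by state; integrating it against \<open>f\<close> and
  exchanging the two sums yields the one-sided invariance that the moment estimate takes as
  hypothesis.\<close>

lemma stationary_le_step:
  assumes "stationary_distribution M \<phi> \<pi>"
  shows "(\<integral>\<^sup>+ x. f x \<partial>measure_pmf \<pi>) \<le> (\<integral>\<^sup>+ x. step f x \<partial>measure_pmf \<pi>)"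
proof -
  let ?P = "trans_prob M \<phi> 1"
  have inflow: "ennreal (pmf \<pi> y) \<le> (\<integral>\<^sup>+ x. ennreal (pmf \<pi> x * ?P x y) \<partial>count_space UNIV)" for y
  proof (rule tendsto_upperbound)
    have "((\<lambda>x. pmf \<pi> x * ?P x y) has_sum pmf \<pi> y) UNIV"
      using assms by (simp add: stationary_distribution_def)
    thus "((\<lambda>F. ennreal (\<Sum>x\<in>F. pmf \<pi> x * ?P x y)) \<longlongrightarrow> ennreal (pmf \<pi> y)) (finite_subsets_at_top UNIV)"
      unfolding has_sum_def by (rule tendsto_ennrealI)
    show "\<forall>\<^sub>F F in finite_subsets_at_top UNIV. ennreal (\<Sum>x\<in>F. pmf \<pi> x * ?P x y) \<le>
        (\<integral>\<^sup>+ x. ennreal (pmf \<pi> x * ?P x y) \<partial>count_space UNIV)"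
    proof (rule eventually_finite_subsets_at_top_weakI)
      fix F :: "'x set" assume F: "finite F"
      have "ennreal (\<Sum>x\<in>F. pmf \<pi> x * ?P x y) = (\<Sum>x\<in>F. ennreal (pmf \<pi> x * ?P x y))"
        by (rule sum_ennreal[symmetric]) (simp add: trans_prob_def)
      also have "\<dots> \<le> (\<integral>\<^sup>+ x. ennreal (pmf \<pi> x * ?P x y) \<partial>count_space UNIV)"
        by (rule sum_le_nn_integral_count_space[OF F])
      finally show "ennreal (\<Sum>x\<in>F. pmf \<pi> x * ?P x y) \<le>
        (\<integral>\<^sup>+ x. ennreal (pmf \<pi> x * ?P x y) \<partial>count_space UNIV)" .
    qed
  qed simp
  have "(\<integral>\<^sup>+ y. f y \<partial>measure_pmf \<pi>) \<le>
      (\<integral>\<^sup>+ y. (\<integral>\<^sup>+ x. ennreal (pmf \<pi> x * ?P x y) \<partial>count_space UNIV) * f y \<partial>count_space UNIV)"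
    unfolding nn_integral_measure_pmf by (intro nn_integral_mono mult_right_mono inflow) simp
  also have "\<dots> = (\<integral>\<^sup>+ y. (\<integral>\<^sup>+ x. ennreal (pmf \<pi> x) * (f y * ennreal (?P x y)) \<partial>count_space UNIV) \<partial>count_space UNIV)"
    by (simp add: nn_integral_cmult[symmetric] ennreal_mult trans_prob_def ac_simps)
  also have "\<dots> = (\<integral>\<^sup>+ x. (\<integral>\<^sup>+ y. ennreal (pmf \<pi> x) * (f y * ennreal (?P x y)) \<partial>count_space UNIV) \<partial>count_space UNIV)"
    by (rule nn_integral_count_space_nn_integral) (auto intro: countableI_type)
  also have "\<dots> = (\<integral>\<^sup>+ x. step f x \<partial>measure_pmf \<pi>)"
    by (simp add: nn_integral_measure_pmf step_eq_trans_prob nn_integral_cmult)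
  finally show ?thesis .
qed

section \<open>From random attractors to finite-valued ones\<close>

lemma random_attractor_AE_finite: "random_attractor M \<theta> \<phi> A \<Longrightarrow> AE \<omega> in M. finite (A \<omega>)"
  by (simp add: random_attractor_def invariant_compact_random_set_def compact_random_set_def)

lemma random_attractor_AE_finite_iterates:
  assumes "random_attractor M \<theta> \<phi> A"
  shows "AE \<omega> in M. \<forall>n. finite (A (\<theta> (int n) \<omega>))"
  unfolding AE_all_countable using AE_theta[OF random_attractor_AE_finite[OF assms]] by blast

text \<open>Replacing infinite values by the empty set changes \<open>A\<close> on a null set only.
  Membership in the past survives because the new events are countable unions of events
  \<open>A \<omega> = B\<close>.\<close>

lemma markov_attractor_finite_part:
  assumes A: "random_attractor M \<theta> \<phi> A"
  shows "markov_attractor M \<theta> \<phi> (\<lambda>\<omega>. if finite (A \<omega>) then A \<omega> else {})"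
    (is "markov_attractor M \<theta> \<phi> ?A'")
proof -
  let ?F = "F_past M \<theta> \<phi> 0"
  have "{\<omega> \<in> space ?F. x \<in> A \<omega>} \<in> sets ?F" for x
  proof -
    have "(\<lambda>\<omega>. indicat_real (A \<omega>) x) \<in> borel_measurable ?F"
      using A by (simp add: random_attractor_def)
    from measurable_sets[OF this, of "{1}"] show ?thesis
      by (rule back_subst[of "\<lambda>E. E \<in> sets ?F"]) (auto simp: indicator_def)
  qed
  hence eq: "{\<omega> \<in> space ?F. A \<omega> = B} \<in> sets ?F" for B
    by (rule set_valued_eq_sets)
  have agree: "AE \<omega> in M. \<forall>n. ?A' (\<theta> (int n) \<omega>) = A (\<theta> (int n) \<omega>)"
    using random_attractor_AE_finite_iterates[OF A] by eventually_elim simp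
  show ?thesis
  proof unfold_locales
    show "finite (?A' \<omega>)" for \<omega> by simp
    show "{\<omega> \<in> space M. x \<in> ?A' \<omega>} \<in> sets ?F" for x
    proof -
      have "{\<omega> \<in> space M. x \<in> ?A' \<omega>} = (\<Union>B\<in>{B. finite B \<and> x \<in> B}. {\<omega> \<in> space ?F. A \<omega> = B})"
        by auto
      also have "\<dots> \<in> sets ?F"
        using eq by (intro sets.countable_UN' countable_subset[OF _ countable_finite_sets]) auto
      finally show ?thesis .
    qed
    have "AE \<omega> in M. \<phi> \<omega> 1 ` A \<omega> = A (\<theta> 1 \<omega>)"
      using A by (simp add: random_attractor_def invariant_compact_random_set_def)
    thus "AE \<omega> in M. \<phi> \<omega> 1 ` ?A' \<omega> = ?A' (\<theta> 1 \<omega>)"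
      using random_attractor_AE_finite[OF A]
    proof eventually_elim
      case (elim \<omega>)
      hence "finite (A (\<theta> 1 \<omega>))" by (metis finite_imageI)
      with elim show ?case by simp
    qed
    show "AE \<omega> in M. \<exists>N. \<forall>n\<ge>N. \<phi> \<omega> n x \<in> ?A' (\<theta> (int n) \<omega>)" for x
    proof -
      \<comment> \<open>Forward attraction is applied to the deterministic singleton.\<close>
      have "compact_random_set M (\<lambda>_. {x})"
        by (simp add: compact_random_set_def)
      hence "\<P>(\<omega> in M. \<exists>N. \<forall>n\<ge>N. \<phi> \<omega> n ` {x} \<subseteq> A (\<theta> (int n) \<omega>)) = 1"
        using A unfolding random_attractor_def by blast
      hence "AE \<omega> in M. \<exists>N. \<forall>n\<ge>N. \<phi> \<omega> n ` {x} \<subseteq> A (\<theta> (int n) \<omega>)"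
        by (rule AE_in_set_if_prob_1)
      with agree show ?thesis
        by eventually_elim simp
    qed
  qed
qed

text \<open>The drift estimate uses \<open>taboo_green a (- C)\<close>, which is then enlarged to
  \<open>S = UNIV\<close>. The constant \<open>c\<close> does not depend on \<open>x\<close>, so the
  bound can be integrated against \<pi>.\<close>

lemma expected_hitting_time_bound:
  assumes irred: "irreducible_chain M \<phi>" and A: "random_attractor M \<theta> \<phi> A"
    and deg2: "(\<Sum>n. of_nat (Suc n) * step (taboo a UNIV n) a) < \<infinity>"
  obtains c where "c < \<infinity>"
    "\<And>x. (\<integral>\<^sup>+ \<omega>. ennreal_of_enat (hitting_time \<theta> \<phi> A \<omega> x) \<partial>M) \<le> 2 * (taboo_green a UNIV x + c)"
proof -
  define A' where "A' \<omega> = (if finite (A \<omega>) then A \<omega> else {})" for \<omega>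
  interpret A': markov_attractor M \<theta> \<phi> A'
    unfolding A'_def by (rule markov_attractor_finite_part[OF A])
  have hit: "(\<integral>\<^sup>+ \<omega>. ennreal_of_enat (hitting_time \<theta> \<phi> A \<omega> x) \<partial>M) =
      (\<integral>\<^sup>+ \<omega>. ennreal_of_enat (hitting_time \<theta> \<phi> A' \<omega> x) \<partial>M)" for x
  proof (rule nn_integral_cong_AE)
    have "AE \<omega> in M. \<forall>n. A' (\<theta> (int n) \<omega>) = A (\<theta> (int n) \<omega>)"
      using random_attractor_AE_finite_iterates[OF A] by eventually_elim (simp add: A'_def)
    thus "AE \<omega> in M. ennreal_of_enat (hitting_time \<theta> \<phi> A \<omega> x) = ennreal_of_enat (hitting_time \<theta> \<phi> A' \<omega> x)"
      by eventually_elim (simp add: hitting_time_def)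
  qed
  have step_fin: "step (taboo_green a UNIV) a < \<infinity>"
    by (rule step_taboo_green_finite[OF deg2])
  have half_pos: "(0 :: ennreal) < ennreal (1/2)"
    by (subst ennreal_less_zero_iff) simp
  \<comment> \<open>With 1/2, the increase at \<open>a\<close> leaves half of the decrease 1 gained
    outside \<open>C\<close>.\<close>
  obtain C where C: "finite C" "a \<in> C" "step (taboo_green a (- C)) a < ennreal (1/2)"
    by (rule step_taboo_green_small[OF step_fin half_pos])
  obtain N where N: "AE \<omega> in M. A' \<omega> \<subseteq> C \<longrightarrow> (\<forall>y\<in>C. A'.nonmerge_prob N y (A' \<omega>) < ennreal (1/2))"
    by (rule A'.nonmerge_prob_uniform[OF C(1) half_pos])
  let ?V = "taboo_green a UNIV"
  define c where "c = (\<integral>\<^sup>+ \<omega>. (\<Sum>y\<in>A' \<omega>. ?V y) \<partial>M) + 2 * of_nat N"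
  show ?thesis
  proof (rule that)
    show "c < \<infinity>"
      using A'.nn_integral_sum_A_finite[OF taboo_green_finite[OF irred step_fin] deg2]
      by (simp add: c_def ennreal_mult_less_top of_nat_less_top)
    fix x
    have "(\<integral>\<^sup>+ \<omega>. ennreal_of_enat (hitting_time \<theta> \<phi> A \<omega> x) \<partial>M) \<le> (\<Sum>k. A'.nonhit_prob x k)"
      unfolding hit by (rule A'.nn_integral_hitting_time_le)
    also have "\<dots> \<le> 2 * (taboo_green a (- C) x + (\<integral>\<^sup>+ \<omega>. (\<Sum>y\<in>A' \<omega>. taboo_green a (- C) y) \<partial>M) + 2 * of_nat N)"
      using C by (intro A'.suminf_nonhit_prob_le[OF taboo_green_drift N] less_imp_le)
    also have "\<dots> \<le> 2 * (?V x + (\<integral>\<^sup>+ \<omega>. (\<Sum>y\<in>A' \<omega>. ?V y) \<partial>M) + 2 * of_nat N)"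
      by (intro mult_left_mono add_mono nn_integral_mono sum_mono taboo_green_mono) auto
    also have "\<dots> = 2 * (?V x + c)"
      by (simp add: c_def add.assoc)
    finally show "(\<integral>\<^sup>+ \<omega>. ennreal_of_enat (hitting_time \<theta> \<phi> A \<omega> x) \<partial>M) \<le> 2 * (?V x + c)" .
  qed
qed

end

theorem theorem4p3:
  fixes M :: "'w measure"
    and \<theta> :: "int \<Rightarrow> 'w \<Rightarrow> 'w"
    and \<phi> :: "'w \<Rightarrow> nat \<Rightarrow> 'x::countable \<Rightarrow> 'x"
    and \<pi> :: "'x pmf"
    and A :: "'w \<Rightarrow> 'x set"
  assumes "markov_rds M \<theta> \<phi>"
    and "irreducible_chain M \<phi>"
    and "positive_recurrent_chain M \<phi>"
    and "stationary_distribution M \<phi> \<pi>"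
    and "random_attractor M \<theta> \<phi> A"
    and "ergodic_of_degree_2 M \<phi>"
  shows "(\<forall>x. (\<integral>\<^sup>+ \<omega>. ennreal_of_enat (hitting_time \<theta> \<phi> A \<omega> x) \<partial>M) < \<infinity>) \<and>
    (\<Sum>\<^sub>\<infinity>x. ennreal (pmf \<pi> x) * (\<integral>\<^sup>+ \<omega>. ennreal_of_enat (hitting_time \<theta> \<phi> A \<omega> x) \<partial>M)) < \<infinity>"
proof -
  interpret markov_rds M \<theta> \<phi> by fact
  obtain a where "(\<integral>\<^sup>+ \<omega>. (ennreal_of_enat (return_time \<phi> \<omega> a))\<^sup>2 \<partial>M) < \<infinity>"
    using assms(6) by (auto simp: ergodic_of_degree_2_def)
  hence deg2: "(\<Sum>n. of_nat (Suc n) * step (taboo a UNIV n) a) < \<infinity>"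
    by (rule suminf_step_taboo_finite)
  let ?V = "taboo_green a UNIV"
  let ?T = "\<lambda>x. \<integral>\<^sup>+ \<omega>. ennreal_of_enat (hitting_time \<theta> \<phi> A \<omega> x) \<partial>M"
  obtain c where c: "c < \<infinity>" "\<And>x. ?T x \<le> 2 * (?V x + c)"
    using expected_hitting_time_bound[OF assms(2,5) deg2] by blast
  have V: "?V x < \<infinity>" for x
    by (rule taboo_green_finite[OF assms(2) step_taboo_green_finite[OF deg2]])
  \<comment> \<open>The estimate already used for the intensity measure of the attractor, now with
    \<pi> as the finite measure.\<close>
  have \<pi>V: "(\<integral>\<^sup>+ x. ?V x \<partial>measure_pmf \<pi>) < \<infinity>"
    by (rule nn_integral_taboo_green_finite[OF _ _ stationary_le_step[OF assms(4)] V deg2])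
       (auto simp: measure_pmf.emeasure_eq_measure)
  have "?T x < \<infinity>" for x
    using c(1) V[of x] by (intro le_less_trans[OF c(2)]) (simp add: ennreal_mult_less_top)
  moreover have "(\<Sum>\<^sub>\<infinity>x. ennreal (pmf \<pi> x) * ?T x) \<le> (\<integral>\<^sup>+ x. 2 * (?V x + c) \<partial>measure_pmf \<pi>)"
  proof (rule infsum_le_finite_sums)
    fix F :: "'x set" assume F: "finite F"
    have "(\<Sum>x\<in>F. ennreal (pmf \<pi> x) * ?T x) \<le> (\<Sum>x\<in>F. ennreal (pmf \<pi> x) * (2 * (?V x + c)))"
      by (intro sum_mono mult_left_mono c) simp
    also have "\<dots> \<le> (\<integral>\<^sup>+ x. 2 * (?V x + c) \<partial>measure_pmf \<pi>)"
      unfolding nn_integral_measure_pmf by (rule sum_le_nn_integral_count_space[OF F])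
    finally show "(\<Sum>x\<in>F. ennreal (pmf \<pi> x) * ?T x) \<le> (\<integral>\<^sup>+ x. 2 * (?V x + c) \<partial>measure_pmf \<pi>)" .
  qed (simp add: nonneg_summable_on_complete)
  moreover have "(\<integral>\<^sup>+ x. 2 * (?V x + c) \<partial>measure_pmf \<pi>) < \<infinity>"
    using \<pi>V c(1) by (simp add: nn_integral_cmult nn_integral_add ennreal_mult_less_top
      measure_pmf.emeasure_space_1[simplified])
  ultimately show ?thesis by (auto intro: le_less_trans)
qed

end
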